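(* Let $n\ge 1$ and let $M=C_n(\mathbb{R}^3)=\{(x_1,\dots,x_n)\in(\mathbb{R}^3)^n : x_i\neq x_j \text{ for } i\neq j\}$ be the configuration space of $n$ distinct ordered particles in $\mathbb{R}^3$. Then $\mathbf{TC}(M)=2n-1$.
   Context: For a connected CW complex (or space of that homotopy type) $X$, let $PX$ be the space of all continuous paths $\gamma:[0,1]\to X$ with the compact-open topology, and let $\pi:PX\to X\times X$, $\pi(\gamma)=(\gamma(0),\gamma(1))$. The topological complexity $\mathbf{TC}(X)$ is the smallest number $k$ such that $X\times X$ can be covered by $k$ open sets $U_1,\dots,U_k$ such that for every $i=1,\dots,k$ there is a continuous map $s_i:U_i\to PX$ with $\pi\circ s_i=\mathrm{id}_{U_i}$. (This is the unreduced normalization: $\mathbf{TC}$ of a contractible space is $1$.) *)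

theory Defs
  imports "HOL-Analysis.Analysis" "HOL-Library.Extended_Nat"
begin

text \<open>
  The continuous maps from \<open>X\<close> to \<open>Y\<close> as a set of HOL functions: a map is only determined on
  \<open>topspace X\<close>, so representatives are taken to be extensional (equal to \<open>undefined\<close> elsewhere).
\<close>

definition continuous_maps :: "'a topology \<Rightarrow> 'b topology \<Rightarrow> ('a \<Rightarrow> 'b) set" where
  "continuous_maps X Y = {f \<in> extensional (topspace X). continuous_map X Y f}"

definition compact_open_topology :: "'a topology \<Rightarrow> 'b topology \<Rightarrow> ('a \<Rightarrow> 'b) topology" where
  "compact_open_topology X Y =
     topology_generated_by
       {{f \<in> continuous_maps X Y. f ` K \<subseteq> U} | K U. compactin X K \<and> openin Y U}"

text \<open>The subbasic set for \<open>K = {}\<close> is everything, so the generated topology has the intended carrier.\<close>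

lemma topspace_compact_open_topology [simp]:
  "topspace (compact_open_topology X Y) = continuous_maps X Y"
proof -
  have "continuous_maps X Y \<in>
      {{f \<in> continuous_maps X Y. f ` K \<subseteq> U} | K U. compactin X K \<and> openin Y U}"
    by (rule CollectI, rule exI[of _ "{}"], rule exI[of _ "{}"]) auto
  then show ?thesis
    unfolding compact_open_topology_def topology_generated_by_topspace by blast
qed

definition path_space :: "'a topology \<Rightarrow> (real \<Rightarrow> 'a) topology" where
  "path_space X = compact_open_topology (top_of_set {0..1}) X"

definition path_ends :: "(real \<Rightarrow> 'a) \<Rightarrow> 'a \<times> 'a" where
  "path_ends \<gamma> = (\<gamma> 0, \<gamma> 1)"

definition has_motion_planner :: "'a topology \<Rightarrow> ('a \<times> 'a) set \<Rightarrow> bool" where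
  "has_motion_planner X U \<longleftrightarrow>
     (\<exists>s. continuous_map (subtopology (prod_topology X X) U) (path_space X) s \<and>
          (\<forall>z\<in>U. path_ends (s z) = z))"

text \<open>
  Unreduced normalization. The infimum in \<^typ>\<open>enat\<close> is attained whenever some finite cover
  exists, and is \<open>\<infinity>\<close> otherwise.
\<close>

definition topological_complexity :: "'a topology \<Rightarrow> enat" where
  "topological_complexity X =
     Inf {enat k | k. \<exists>U :: nat \<Rightarrow> ('a \<times> 'a) set.
            (\<forall>i\<in>{1..k}. openin (prod_topology X X) (U i) \<and> has_motion_planner X (U i)) \<and>
            (\<Union>i\<in>{1..k}. U i) = topspace (prod_topology X X)}"

text \<open>
  Ordered configurations of \<open>n\<close> distinct points of \<open>X\<close>, topologized as a subspace of the
  \<open>n\<close>-fold power of \<open>X\<close>, whose points are the functions on the index set \<open>{1..n}\<close>.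
\<close>

definition configuration_space :: "nat \<Rightarrow> 'a topology \<Rightarrow> (nat \<Rightarrow> 'a) topology" where
  "configuration_space n X =
     subtopology (product_topology (\<lambda>_. X) {1..n})
       {x. \<forall>i\<in>{1..n}. \<forall>j\<in>{1..n}. i \<noteq> j \<longrightarrow> x i \<noteq> x j}"

end

theory Submission
  imports Defs
begin

text \<open>
  Upper bound. On pairs of configurations, consider the partition of the \<open>2n\<close> particles by the
  values of their first coordinates. Near each stratum the two configurations can be straightened,
  without collisions, to fixed ones, so there is a motion planner; and suitable neighbourhoods of
  two different strata with the same number of blocks are disjoint. The number of blocks
  takes \<open>2n - 1\<close> values.

  Lower bound. Put \<open>m = n - 1\<close>. The directions from the first particle to the other ones map the
  configuration space to \<open>(\<real>\<^sup>3 - 0)\<^sup>m\<close>, and the \<open>4m\<close>-torus maps to pairs of configurations so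
  that each direction becomes a map of degree one on its own 2-torus. If \<open>\<omega>\<close> is the fundamental
  2-cocycle of \<open>\<real>\<^sup>3 - 0\<close>, a motion planner over \<open>U\<close> makes each zero divisor
  \<open>z\<^sub>j = \<omega>(x\<^sub>j) - \<omega>(y\<^sub>j)\<close> exact over \<open>U\<close>. With \<open>2m\<close> planners the product
  \<open>z\<^sub>1\<^sup>2 \<dots> z\<^sub>m\<^sup>2\<close> would therefore be exact on the torus, but its integral is \<open>(-2)\<^sup>m\<close>. All of
  this is carried out with Alexander--Spanier cochains on a fine lattice in the torus: a cochain is a
  function on lists of vertices, the cup product is front face times back face, and the
  fundamental class is an iterated prism operator. The cocycle \<open>\<omega>\<close> counts triangles whose
  vertices carry the labels 1, 2, 3 of a closed cover of \<open>\<real>\<^sup>3 - 0\<close> by four cones with empty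
  common intersection.
\<close>

subsection \<open>Cochains on lists of vertices\<close>

text \<open>The alternating sum over the faces, by recursion on the first vertex. The complex is
  augmented: the empty list is a simplex of degree -1, so on \<open>[v]\<close> the coboundary is
  \<open>\<phi> []\<close>.\<close>

primrec coboundary :: "('v list \<Rightarrow> int) \<Rightarrow> 'v list \<Rightarrow> int" where
  "coboundary \<phi> [] = 0"
| "coboundary \<phi> (v # vs) = \<phi> vs - coboundary (\<lambda>ws. \<phi> (v # ws)) vs"

text \<open>A \<open>p\<close>-simplex is a list of \<open>p + 1\<close> vertices, and \<open>p\<close> below is the degree of \<open>\<phi>\<close>.\<close>

definition cup :: "nat \<Rightarrow> ('v list \<Rightarrow> int) \<Rightarrow> ('v list \<Rightarrow> int) \<Rightarrow> 'v list \<Rightarrow> int" where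
  "cup p \<phi> \<psi> vs = \<phi> (take (Suc p) vs) * \<psi> (drop p vs)"

text \<open>Alternating sum over the staircase simplices that follow \<open>f\<close> up to some
  vertex, switch to \<open>g\<close> at that vertex and follow \<open>g\<close> from there
  on.\<close>

primrec prism :: "('u \<Rightarrow> 'v) \<Rightarrow> ('u \<Rightarrow> 'v) \<Rightarrow> ('v list \<Rightarrow> int) \<Rightarrow> 'u list \<Rightarrow> int" where
  "prism f g \<phi> [] = 0"
| "prism f g \<phi> (v # vs) =
     \<phi> (f v # g v # map g vs) - prism f g (\<lambda>ws. \<phi> (f v # ws)) vs"

lemma coboundary_diff: "coboundary (\<lambda>ws. \<phi> ws - \<psi> ws) vs = coboundary \<phi> vs - coboundary \<psi> vs"
  by (induction vs arbitrary: \<phi> \<psi>) simp_all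

lemma coboundary_add: "coboundary (\<lambda>ws. \<phi> ws + \<psi> ws) vs = coboundary \<phi> vs + coboundary \<psi> vs"
  by (induction vs arbitrary: \<phi> \<psi>) simp_all

lemma coboundary_cmult: "coboundary (\<lambda>ws. c * \<phi> ws) vs = c * coboundary \<phi> vs"
  by (induction vs arbitrary: \<phi>) (simp_all add: algebra_simps)

lemma coboundary_sum: "coboundary (\<lambda>ws. \<Sum>t\<in>A. \<phi> t ws) vs = (\<Sum>t\<in>A. coboundary (\<phi> t) vs)"
  by (induction vs arbitrary: \<phi>) (simp_all add: sum_subtractf)

lemma coboundary_map: "coboundary (\<lambda>ws. \<phi> (map g ws)) vs = coboundary \<phi> (map g vs)"
  by (induction vs arbitrary: \<phi>) simp_all

lemma coboundary_coboundary: "coboundary (coboundary \<phi>) vs = 0"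
proof (induction vs arbitrary: \<phi>)
  case (Cons v vs)
  have "coboundary (\<lambda>ws. coboundary \<phi> (v # ws)) vs =
      coboundary \<phi> vs - coboundary (coboundary (\<lambda>ws. \<phi> (v # ws))) vs"
    by (simp add: coboundary_diff)
  then show ?case using Cons by simp
qed simp

text \<open>Leibniz rule. The bound on the length ensures that \<open>take\<close> and
  \<open>drop\<close> cut out genuine faces.\<close>

lemma coboundary_cup:
  assumes "length vs \<ge> p + 2"
  shows "coboundary (cup p \<phi> \<psi>) vs =
    cup (Suc p) (coboundary \<phi>) \<psi> vs + (- 1) ^ p * cup p \<phi> (coboundary \<psi>) vs"
  using assms
proof (induction p arbitrary: \<phi> vs)
  case 0
  then obtain v w us where vs: "vs = v # w # us"
    by (cases vs; cases "tl vs") auto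
  have "coboundary (cup 0 \<phi> \<psi>) vs =
      cup 0 \<phi> \<psi> (w # us) - coboundary (\<lambda>ws. \<phi> [v] * \<psi> (v # ws)) (w # us)"
    by (simp add: vs cup_def)
  also have "\<dots> = \<phi> [w] * \<psi> (w # us) - \<phi> [v] * coboundary (\<lambda>ws. \<psi> (v # ws)) (w # us)"
    by (simp only: coboundary_cmult) (simp add: cup_def)
  finally show ?case by (simp add: vs cup_def algebra_simps)
next
  case (Suc p)
  then obtain v us where vs: "vs = v # us" and len: "length us \<ge> p + 2"
    by (cases vs) auto
  have eq: "(\<lambda>ws. cup (Suc p) \<phi> \<psi> (v # ws)) = cup p (\<lambda>ws. \<phi> (v # ws)) \<psi>"
    by (simp add: cup_def fun_eq_iff)
  have "coboundary (cup (Suc p) \<phi> \<psi>) vs =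
      cup (Suc p) \<phi> \<psi> us - coboundary (cup p (\<lambda>ws. \<phi> (v # ws)) \<psi>) us"
    by (simp add: vs eq)
  also note Suc.IH[OF len, of "\<lambda>ws. \<phi> (v # ws)"]
  finally show ?case by (simp add: vs cup_def algebra_simps)
qed

section \<open>Prism operators as chain homotopies\<close>

lemma prism_diff: "prism f g (\<lambda>ws. \<phi> ws - \<psi> ws) vs = prism f g \<phi> vs - prism f g \<psi> vs"
  by (induction vs arbitrary: \<phi> \<psi>) simp_all

lemma prism_minus: "prism f g (\<lambda>ws. - \<phi> ws) vs = - prism f g \<phi> vs"
  by (induction vs arbitrary: \<phi>) simp_all

lemma prism_cmult: "prism f g (\<lambda>ws. c * \<phi> ws) vs = c * prism f g \<phi> vs"
  by (induction vs arbitrary: \<phi>) (simp_all add: algebra_simps)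

lemma prism_map: "prism f g \<phi> (map h vs) = prism (f \<circ> h) (g \<circ> h) \<phi> vs"
  by (induction vs arbitrary: \<phi>) (simp_all add: comp_def)

lemma prism_map': "prism f g (\<lambda>ws. \<phi> (map h ws)) vs = prism (h \<circ> f) (h \<circ> g) \<phi> vs"
  by (induction vs arbitrary: \<phi>) (simp_all add: comp_def)

text \<open>Makes identities that hold only for small simplices usable under a prism operator: every
  list that gets evaluated consists of image vertices of \<open>f\<close> and
  \<open>g\<close>.\<close>

lemma prism_cong:
  assumes "\<And>ws. set ws \<subseteq> f ` set vs \<union> g ` set vs \<Longrightarrow> length ws = Suc (length vs) \<Longrightarrow> \<phi> ws = \<psi> ws"
  shows "prism f g \<phi> vs = prism f g \<psi> vs"
  using assms
proof (induction vs arbitrary: \<phi> \<psi>)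
  case (Cons v vs)
  have "prism f g (\<lambda>ws. \<phi> (f v # ws)) vs = prism f g (\<lambda>ws. \<psi> (f v # ws)) vs"
  proof (rule Cons.IH)
    fix ws assume "set ws \<subseteq> f ` set vs \<union> g ` set vs" "length ws = Suc (length vs)"
    then show "\<phi> (f v # ws) = \<psi> (f v # ws)"
      by (intro Cons.prems) auto
  qed
  moreover have "\<phi> (f v # g v # map g vs) = \<psi> (f v # g v # map g vs)"
    by (rule Cons.prems) auto
  ultimately show ?case by simp
qed simp

text \<open>After the first vertex is peeled off, the two terms \<open>prism f g \<phi> vs\<close>
  and the two coboundaries of \<open>\<lambda>ws. \<phi> (f v # g v # ws)\<close> cancel. What
  remains telescopes with the induction hypothesis for
  \<open>\<lambda>ws. \<phi> (f v # ws)\<close>.\<close>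

lemma prism_homotopy:
  "coboundary (prism f g \<phi>) vs + prism f g (coboundary \<phi>) vs = \<phi> (map g vs) - \<phi> (map f vs)"
proof (induction vs arbitrary: \<phi>)
  case (Cons v vs)
  have 1: "coboundary (\<lambda>ws. prism f g \<phi> (v # ws)) vs =
      coboundary (\<lambda>ws. \<phi> (f v # g v # ws)) (map g vs)
      - coboundary (prism f g (\<lambda>ws. \<phi> (f v # ws))) vs"
    by (simp add: coboundary_diff coboundary_map [of "\<lambda>ws. \<phi> (f v # g v # ws)"])
  have 2: "prism f g (\<lambda>ws. coboundary \<phi> (f v # ws)) vs =
      prism f g \<phi> vs - prism f g (coboundary (\<lambda>ws. \<phi> (f v # ws))) vs"
    by (simp add: prism_diff)
  show ?case using 1 2 Cons.IH[of "\<lambda>ws. \<phi> (f v # ws)"] by simp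
qed simp

text \<open>A staircase simplex that switches from \<open>f\<close> to \<open>g\<close> inside the
  front face is killed by the second hypothesis, so only switches inside the back face survive. The
  sign counts the \<open>p\<close> vertices that come before.\<close>

lemma prism_cup_left:
  assumes "\<And>us. length us = Suc p \<Longrightarrow> \<alpha> (map f us) = \<alpha>' us"
    and "\<And>us v ws. length us + length ws + 2 = Suc p \<Longrightarrow>
      \<alpha> (map f us @ f v # g v # map g ws) = 0"
    and "length vs \<ge> Suc p"
  shows "prism f g (cup p \<alpha> \<beta>) vs = (- 1) ^ p * cup p \<alpha>' (prism f g \<beta>) vs"
  using assms
proof (induction p arbitrary: \<alpha> \<alpha>' vs)
  case 0
  then obtain v us where vs: "vs = v # us" by (cases vs) auto
  have eq: "(\<lambda>ws. cup 0 \<alpha> \<beta> (f v # ws)) = (\<lambda>ws. \<alpha> [f v] * \<beta> (f v # ws))"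
    by (simp add: cup_def)
  have "prism f g (cup 0 \<alpha> \<beta>) vs = \<alpha> [f v] * prism f g \<beta> vs"
    unfolding vs prism.simps eq prism_cmult by (simp add: cup_def algebra_simps)
  then show ?case using 0(1)[of "[v]"] by (simp add: cup_def vs)
next
  case (Suc p)
  then obtain v us where vs: "vs = v # us" and len: "length us \<ge> Suc p" by (cases vs) auto
  have eq: "(\<lambda>ws. cup (Suc p) \<alpha> \<beta> (f v # ws)) = cup p (\<lambda>ws. \<alpha> (f v # ws)) \<beta>"
    by (simp add: cup_def fun_eq_iff)
  have "\<alpha> (take (Suc (Suc p)) (f v # g v # map g us)) = 0"
    using Suc.prems(2)[of "[]" "take p us" v] len by (simp add: take_map)
  then have 1: "cup (Suc p) \<alpha> \<beta> (f v # g v # map g us) = 0"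
    by (simp add: cup_def)
  have "prism f g (cup p (\<lambda>ws. \<alpha> (f v # ws)) \<beta>) us =
      (- 1) ^ p * cup p (\<lambda>ws. \<alpha>' (v # ws)) (prism f g \<beta>) us"
  proof (rule Suc.IH[OF _ _ len])
    show "\<alpha> (f v # map f us) = \<alpha>' (v # us)" if "length us = Suc p" for us
      using Suc.prems(1)[of "v # us"] that by simp
    show "\<alpha> (f v # map f us @ f v' # g v' # map g ws) = 0"
      if "length us + length ws + 2 = Suc p" for us v' ws
      using Suc.prems(2)[of "v # us" ws v'] that by simp
  qed
  then show ?case unfolding vs prism.simps eq 1 by (simp add: cup_def)
qed

subsection \<open>Integration over a lattice torus\<close>

text \<open>Integration along the \<open>c\<close>-th circle, one prism for each of its
  \<open>N\<close> edges. It lowers the degree by one and overwrites coordinate \<open>c\<close> of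
  every vertex.\<close>

definition circle_integral :: "nat \<Rightarrow> nat \<Rightarrow> ((nat \<Rightarrow> nat) list \<Rightarrow> int) \<Rightarrow> (nat \<Rightarrow> nat) list \<Rightarrow> int" where
  "circle_integral N c \<phi> vs = (\<Sum>t<N. prism (\<lambda>v. v(c := t)) (\<lambda>v. v(c := Suc t)) \<phi> vs)"

text \<open>The highest coordinate is integrated first, so that the last factors of a product, which
  live on the last coordinates, are evaluated first.\<close>

primrec torus_integral :: "nat \<Rightarrow> nat \<Rightarrow> ((nat \<Rightarrow> nat) list \<Rightarrow> int) \<Rightarrow> (nat \<Rightarrow> nat) list \<Rightarrow> int" where
  "torus_integral N 0 \<phi> = \<phi>"
| "torus_integral N (Suc d) \<phi> = torus_integral N d (circle_integral N d \<phi>)"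

text \<open>The values \<open>0\<close> and \<open>N\<close> of a coordinate are different lattice
  points over the same point of the circle. Agreement on these two end faces is what removes the
  boundary terms from Stokes' formula.\<close>

definition periodic :: "nat \<Rightarrow> nat \<Rightarrow> ((nat \<Rightarrow> nat) list \<Rightarrow> int) \<Rightarrow> bool" where
  "periodic N d \<phi> \<longleftrightarrow>
     (\<forall>c<d. \<forall>vs. \<phi> (map (\<lambda>v. v(c := N)) vs) = \<phi> (map (\<lambda>v. v(c := 0)) vs))"

text \<open>The unit cube with lowest corner \<open>w\<close>. It plays the role of smallness for
  Alexander--Spanier cochains: identities are only asked for simplices inside one cube.\<close>

definition in_cell :: "nat \<Rightarrow> (nat \<Rightarrow> nat) \<Rightarrow> (nat \<Rightarrow> nat) list \<Rightarrow> bool" where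
  "in_cell d w vs \<longleftrightarrow> (\<forall>v\<in>set vs. \<forall>c<d. v c = w c \<or> v c = Suc (w c))"

lemma in_cell_subset: "in_cell d w vs \<Longrightarrow> set ws \<subseteq> set vs \<Longrightarrow> in_cell d w ws"
  unfolding in_cell_def by blast

lemma in_cell_take: "in_cell d w vs \<Longrightarrow> in_cell d w (take k vs)"
  by (meson in_cell_subset set_take_subset)

lemma in_cell_drop: "in_cell d w vs \<Longrightarrow> in_cell d w (drop k vs)"
  by (meson in_cell_subset set_drop_subset)

lemma circle_integral_cong:
  assumes "\<And>ws. length ws = Suc (length vs) \<Longrightarrow> \<phi> ws = \<psi> ws"
  shows "circle_integral N c \<phi> vs = circle_integral N c \<psi> vs"
  unfolding circle_integral_def by (intro sum.cong prism_cong assms) auto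

lemma circle_integral_minus:
  "circle_integral N c (\<lambda>ws. - \<phi> ws) vs = - circle_integral N c \<phi> vs"
  by (simp add: circle_integral_def prism_minus sum_negf)

lemma circle_integral_cmult:
  "circle_integral N c (\<lambda>ws. k * \<phi> ws) vs = k * circle_integral N c \<phi> vs"
  by (simp add: circle_integral_def prism_cmult sum_distrib_left)

lemma circle_integral_Nil [simp]: "circle_integral N c \<phi> [] = 0"
  by (simp add: circle_integral_def)

lemma torus_integral_minus:
  "torus_integral N d (\<lambda>ws. - \<phi> ws) vs = - torus_integral N d \<phi> vs"
  by (induction d arbitrary: \<phi>) (simp_all add: circle_integral_minus [abs_def])

lemma torus_integral_cmult:
  "torus_integral N d (\<lambda>ws. k * \<phi> ws) vs = k * torus_integral N d \<phi> vs"
  by (induction d arbitrary: \<phi>) (simp_all add: circle_integral_cmult [abs_def])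

lemma torus_integral_Nil: "d > 0 \<Longrightarrow> torus_integral N d \<phi> [] = 0"
proof -
  have "\<phi> [] = 0 \<Longrightarrow> torus_integral N d \<phi> [] = 0" for d \<phi>
    by (induction d arbitrary: \<phi>) simp_all
  then show "d > 0 \<Longrightarrow> torus_integral N d \<phi> [] = 0"
    by (cases d) simp_all
qed

text \<open>Each staircase simplex of the iterated prism lies in a single lattice cube. The position
  of \<open>us\<close> is irrelevant, because all coordinates below \<open>d\<close> are
  overwritten.\<close>

lemma torus_integral_cong:
  assumes "\<And>vs w. length vs = d + k \<Longrightarrow> \<forall>c<d. w c < N \<Longrightarrow> in_cell d w vs \<Longrightarrow> \<phi> vs = \<psi> vs"
    and "length us = k"
  shows "torus_integral N d \<phi> us = torus_integral N d \<psi> us"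
  using assms
proof (induction d arbitrary: \<phi> \<psi>)
  case 0
  then show ?case by (simp add: in_cell_def)
next
  case (Suc d)
  have "torus_integral N d (circle_integral N d \<phi>) us = torus_integral N d (circle_integral N d \<psi>) us"
  proof (rule Suc.IH)
    fix vs w assume vs: "length vs = d + k" "\<forall>c<d. w c < N" "in_cell d w vs"
    show "circle_integral N d \<phi> vs = circle_integral N d \<psi> vs"
      unfolding circle_integral_def
    proof (intro sum.cong refl prism_cong)
      fix t ws assume t: "t \<in> {..<N}"
        and ws: "set ws \<subseteq> (\<lambda>v. v(d := t)) ` set vs \<union> (\<lambda>v. v(d := Suc t)) ` set vs"
          "length ws = Suc (length vs)"
      show "\<phi> ws = \<psi> ws"
      proof (rule Suc.prems(1)[where w = "w(d := t)"])
        show "in_cell (Suc d) (w(d := t)) ws"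
          unfolding in_cell_def
        proof (intro ballI allI impI)
          fix v c assume "v \<in> set ws" "c < Suc d"
          then obtain v' where "v' \<in> set vs" "v = v'(d := t) \<or> v = v'(d := Suc t)"
            using ws(1) by blast
          then show "v c = (w(d := t)) c \<or> v c = Suc ((w(d := t)) c)"
            using vs(3) \<open>c < Suc d\<close>
            by (cases "c = d") (force simp: in_cell_def less_Suc_eq)+
        qed
      qed (use vs t ws(2) in \<open>auto simp: less_Suc_eq\<close>)
    qed
  qed (rule Suc.prems(2))
  then show ?case by simp
qed

text \<open>Stokes' formula: the homotopy identities of the \<open>N\<close> prisms telescope to the
  two end faces, where \<open>\<psi>\<close> takes the same value.\<close>

lemma circle_integral_coboundary:
  assumes "\<And>vs. \<psi> (map (\<lambda>v. v(c := N)) vs) = \<psi> (map (\<lambda>v. v(c := 0)) vs)"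
  shows "circle_integral N c (coboundary \<psi>) vs = - coboundary (circle_integral N c \<psi>) vs"
proof -
  let ?P = "\<lambda>t. prism (\<lambda>v. v(c := t)) (\<lambda>v. v(c := Suc t))"
  have "circle_integral N c (coboundary \<psi>) vs + coboundary (circle_integral N c \<psi>) vs
     = (\<Sum>t<N. coboundary (?P t \<psi>) vs + ?P t (coboundary \<psi>) vs)"
    by (simp add: circle_integral_def [abs_def] coboundary_sum sum.distrib)
  also have "\<dots> = (\<Sum>t<N. \<psi> (map (\<lambda>v. v(c := Suc t)) vs) - \<psi> (map (\<lambda>v. v(c := t)) vs))"
    by (simp add: prism_homotopy)
  also have "\<dots> = 0"
    by (subst sum_lessThan_telescope) (simp add: assms)
  finally show ?thesis by simp
qed

lemma periodic_circle_integral: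
  assumes "periodic N (Suc d) \<psi>"
  shows "periodic N d (circle_integral N d \<psi>)"
  unfolding periodic_def
proof (intro allI impI)
  fix c vs assume "c < d"
  have "prism (\<lambda>v. v(d := t)) (\<lambda>v. v(d := Suc t)) \<psi> (map (\<lambda>v. v(c := N)) vs) =
        prism (\<lambda>v. v(d := t)) (\<lambda>v. v(d := Suc t)) \<psi> (map (\<lambda>v. v(c := 0)) vs)" for t
  proof -
    have *: "prism (\<lambda>v. v(d := t)) (\<lambda>v. v(d := Suc t)) \<psi> (map (\<lambda>v. v(c := x)) vs) =
       prism (\<lambda>v. v(d := t)) (\<lambda>v. v(d := Suc t)) (\<lambda>ws. \<psi> (map (\<lambda>v. v(c := x)) ws)) vs" for x
      unfolding prism_map prism_map' using \<open>c < d\<close>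
      by (simp add: comp_def fun_upd_twist[of c d])
    have "\<psi> (map (\<lambda>v. v(c := N)) ws) = \<psi> (map (\<lambda>v. v(c := 0)) ws)" for ws
      using assms \<open>c < d\<close> by (simp add: periodic_def)
    then show ?thesis unfolding * by simp
  qed
  then show "circle_integral N d \<psi> (map (\<lambda>v. v(c := N)) vs) =
      circle_integral N d \<psi> (map (\<lambda>v. v(c := 0)) vs)"
    by (simp add: circle_integral_def)
qed

lemma torus_integral_coboundary:
  assumes "periodic N d \<psi>"
  shows "torus_integral N d (coboundary \<psi>) vs = (- 1) ^ d * coboundary (torus_integral N d \<psi>) vs"
  using assms
proof (induction d arbitrary: \<psi>)
  case (Suc d)
  have "circle_integral N d (coboundary \<psi>) = (\<lambda>vs. - coboundary (circle_integral N d \<psi>) vs)"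
    using Suc.prems by (intro ext circle_integral_coboundary) (simp add: periodic_def)
  then show ?case
    using Suc.IH[OF periodic_circle_integral[OF Suc.prems]]
    by (simp add: torus_integral_minus)
qed simp

text \<open>On a single vertex the augmented coboundary of the integral is its value on the empty
  list, which vanishes once at least one circle has been integrated.\<close>

lemma torus_integral_exact:
  assumes "periodic N d \<psi>" "d > 0"
  shows "torus_integral N d (coboundary \<psi>) [u] = 0"
  using torus_integral_coboundary[OF assms(1)] torus_integral_Nil[OF assms(2)] by simp

lemma periodic_coboundary: "periodic N d \<psi> \<Longrightarrow> periodic N d (coboundary \<psi>)"
  unfolding periodic_def by (simp flip: coboundary_map)

lemma periodic_add: "periodic N d \<phi> \<Longrightarrow> periodic N d \<psi> \<Longrightarrow> periodic N d (\<lambda>vs. \<phi> vs + \<psi> vs)"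
  unfolding periodic_def by simp

lemma periodic_cup: "periodic N d \<phi> \<Longrightarrow> periodic N d \<psi> \<Longrightarrow> periodic N d (cup p \<phi> \<psi>)"
  unfolding periodic_def cup_def by (simp add: take_map drop_map)

section \<open>Cup products of cochains of degree two\<close>

primrec cup_prod :: "(nat \<Rightarrow> 'v list \<Rightarrow> int) \<Rightarrow> nat \<Rightarrow> 'v list \<Rightarrow> int" where
  "cup_prod a 0 = (\<lambda>_. 1)"
| "cup_prod a (Suc k) = cup (2 * k) (cup_prod a k) (a k)"

lemma periodic_cup_prod:
  "(\<And>i. i < k \<Longrightarrow> periodic N d (a i)) \<Longrightarrow> periodic N d (cup_prod a k)"
  by (induction k) (auto intro!: periodic_cup, simp add: periodic_def)

text \<open>Applied cube by cube; the vanishing factor may change from one cube to the next.\<close>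

lemma cup_prod_eq_0:
  assumes "\<And>ws. length ws = 3 \<Longrightarrow> set ws \<subseteq> set vs \<Longrightarrow> a i ws = 0"
    and "i < k" "length vs = 2 * k + 1"
  shows "cup_prod a k vs = 0"
  using assms
proof (induction k arbitrary: vs)
  case (Suc k)
  show ?case
  proof (cases "i = k")
    case True
    have "a k (drop (2 * k) vs) = 0"
      using Suc.prems(1)[of "drop (2 * k) vs"] Suc.prems(3) set_drop_subset[of "2 * k" vs] True
      by simp
    then show ?thesis by (simp add: cup_def)
  next
    case False
    have "cup_prod a k (take (Suc (2 * k)) vs) = 0"
    proof (rule Suc.IH)
      show "a i ws = 0" if "length ws = 3" "set ws \<subseteq> set (take (Suc (2 * k)) vs)" for ws
        using Suc.prems(1) that set_take_subset by (metis subset_trans)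
    qed (use False Suc.prems in auto)
    then show ?thesis by (simp add: cup_def)
  qed
qed simp

lemma coboundary_cup_prod:
  assumes "\<And>i vs. i < k \<Longrightarrow> length vs = 4 \<Longrightarrow> in_cell d w vs \<Longrightarrow> coboundary (a i) vs = 0"
    and "in_cell d w vs" "length vs = 2 * k + 2"
  shows "coboundary (cup_prod a k) vs = 0"
  using assms
proof (induction k arbitrary: vs)
  case 0
  then obtain u v where "vs = [u, v]"
    by (auto simp: length_Suc_conv numeral_2_eq_2)
  then show ?case by simp
next
  case (Suc k)
  have "coboundary (cup_prod a k) (take (Suc (Suc (2 * k))) vs) = 0"
    by (rule Suc.IH) (use Suc.prems in_cell_take in auto)
  moreover have "coboundary (a k) (drop (2 * k) vs) = 0"
    by (rule Suc.prems(1)) (use Suc.prems in_cell_drop in auto)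
  ultimately show ?case
    using Suc.prems(3) by (simp add: coboundary_cup) (simp add: cup_def)
qed

text \<open>The factors are replaced one at a time. If the products of the first \<open>k\<close>
  factors differ by the coboundary of \<open>\<xi>\<close>, the next ones differ by the cup product
  of that coboundary with the new factor, plus the old product times the coboundary of
  \<open>\<eta> k\<close>. Both are exact by the Leibniz rule, since the factors are closed and the
  product has even degree.\<close>

lemma cup_prod_cohomologous:
  assumes closed: "\<And>i vs w. i < k \<Longrightarrow> length vs = 4 \<Longrightarrow> \<forall>c<d. w c < N \<Longrightarrow> in_cell d w vs \<Longrightarrow> coboundary (a i) vs = 0"
    and a: "\<And>i. i < k \<Longrightarrow> periodic N d (a i)"
    and \<eta>: "\<And>i. i < k \<Longrightarrow> periodic N d (\<eta> i)"
  shows "\<exists>\<xi>. periodic N d \<xi> \<and>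
    (\<forall>vs w. length vs = 2 * k + 1 \<longrightarrow> (\<forall>c<d. w c < N) \<longrightarrow> in_cell d w vs \<longrightarrow>
      cup_prod (\<lambda>i vs. a i vs + coboundary (\<eta> i) vs) k vs = cup_prod a k vs + coboundary \<xi> vs)"
  using assms
proof (induction k)
  case 0
  have "coboundary (\<lambda>_. 0) vs = 0" for vs :: "(nat \<Rightarrow> nat) list"
    by (induction vs) simp_all
  then show ?case by (intro exI[of _ "\<lambda>_. 0"]) (simp add: periodic_def)
next
  case (Suc k)
  define c where "c = (\<lambda>i vs. a i vs + coboundary (\<eta> i) vs)"
  have per_c: "periodic N d (c k)"
    unfolding c_def by (intro periodic_add periodic_coboundary Suc.prems) auto
  have "\<exists>\<xi>. periodic N d \<xi> \<and>
    (\<forall>vs w. length vs = 2 * k + 1 \<longrightarrow> (\<forall>c<d. w c < N) \<longrightarrow> in_cell d w vs \<longrightarrow>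
      cup_prod c k vs = cup_prod a k vs + coboundary \<xi> vs)"
    unfolding c_def by (rule Suc.IH) (rule Suc.prems; simp)+
  then obtain \<xi> where \<xi>: "periodic N d \<xi>"
    "\<And>vs w. length vs = 2 * k + 1 \<Longrightarrow> \<forall>c<d. w c < N \<Longrightarrow> in_cell d w vs \<Longrightarrow>
      cup_prod c k vs = cup_prod a k vs + coboundary \<xi> vs"
    by blast
  have per_A: "periodic N d (cup_prod a k)"
    by (intro periodic_cup_prod Suc.prems) auto
  \<comment> \<open>The degree of \<open>\<xi>\<close> is \<open>2 * k - 1\<close>, which would be
    -1 for \<open>k = 0\<close>. There both products are 1, so the coboundary of
    \<open>\<xi>\<close> vanishes on the vertices in question and 0 is the right choice.\<close>
  define \<zeta> where "\<zeta> = (if k = 0 then (\<lambda>_. 0) else cup (2 * k - 1) \<xi> (c k))"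
  define \<xi>' where "\<xi>' = (\<lambda>vs. \<zeta> vs + cup (2 * k) (cup_prod a k) (\<eta> k) vs)"
  have "periodic N d \<zeta>"
    unfolding \<zeta>_def using \<xi>(1) per_c by (auto intro!: periodic_cup simp: periodic_def[of _ _ "\<lambda>_. 0"])
  then have "periodic N d \<xi>'"
    unfolding \<xi>'_def using per_A Suc.prems by (intro periodic_add periodic_cup) auto
  moreover have "cup_prod c (Suc k) vs = cup_prod a (Suc k) vs + coboundary \<xi>' vs"
    if vs: "length vs = 2 * Suc k + 1" and w: "\<forall>c<d. w c < N" "in_cell d w vs" for vs w
  proof -
    have C: "cup_prod c k (take (Suc (2 * k)) vs) =
        cup_prod a k (take (Suc (2 * k)) vs) + coboundary \<xi> (take (Suc (2 * k)) vs)"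
      by (rule \<xi>(2)) (use vs w in_cell_take in auto)
    have "coboundary (cup_prod a k) (take (Suc (Suc (2 * k))) vs) = 0"
      by (rule coboundary_cup_prod[of _ d w]) (use vs w Suc.prems in_cell_take in auto)
    then have 1: "coboundary (cup (2 * k) (cup_prod a k) (\<eta> k)) vs =
        cup (2 * k) (cup_prod a k) (coboundary (\<eta> k)) vs"
      using vs by (simp add: coboundary_cup) (simp add: cup_def)
    have 2: "coboundary \<zeta> vs = cup (2 * k) (coboundary \<xi>) (c k) vs"
    proof (cases k)
      case 0
      have [simp]: "coboundary (\<lambda>_. 0) vs = 0" for vs :: "(nat \<Rightarrow> nat) list"
        by (induction vs) simp_all
      obtain u us where us: "vs = u # us" using vs by (cases vs) auto
      have "coboundary \<xi> [u] = 0"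
        using \<xi>(2)[of "[u]" w] w(1) w(2) 0 by (auto simp: us in_cell_def)
      then show ?thesis using 0 by (simp add: \<zeta>_def cup_def us)
    next
      case (Suc k')
      have "coboundary (c k) (drop (2 * k - 1) vs) = 0"
        unfolding c_def coboundary_add coboundary_coboundary
        using Suc.prems(1)[of k "drop (2 * k - 1) vs" w] vs w in_cell_drop Suc by auto
      then show ?thesis
        using vs Suc by (simp add: \<zeta>_def coboundary_cup) (simp add: cup_def)
    qed
    show ?thesis
      unfolding \<xi>'_def coboundary_add 1 2 using C
      by (simp add: cup_def) (simp add: c_def algebra_simps)
  qed
  ultimately show ?case unfolding c_def by blast
qed

subsection \<open>Products of zero divisors\<close>

text \<open>The pullback of \<open>\<Omega>\<close> evaluated on the fundamental class of a 2-torus,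
  whose \<open>N\<close> times \<open>N\<close> squares are each cut along a diagonal.\<close>

definition lattice_degree :: "nat \<Rightarrow> (nat \<Rightarrow> nat \<Rightarrow> 'l) \<Rightarrow> ('l list \<Rightarrow> int) \<Rightarrow> int" where
  "lattice_degree N lab \<Omega> = (\<Sum>s<N. \<Sum>t<N.
     \<Omega> [lab s t, lab s (Suc t), lab (Suc s) (Suc t)] - \<Omega> [lab s t, lab (Suc s) t, lab (Suc s) (Suc t)])"

definition pullback_cochain :: "(nat \<Rightarrow> nat \<Rightarrow> 'l) \<Rightarrow> ('l list \<Rightarrow> int) \<Rightarrow> nat \<Rightarrow> (nat \<Rightarrow> nat) list \<Rightarrow> int" where
  "pullback_cochain lab \<Omega> c vs = \<Omega> (map (\<lambda>v. lab (v c) (v (Suc c))) vs)"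

text \<open>Coordinates \<open>4j, 4j + 1\<close> of the torus move the \<open>j\<close>-th direction of the first configuration,
  \<open>4j + 2, 4j + 3\<close> that of the second one.\<close>

definition zero_divisor :: "(nat \<Rightarrow> nat \<Rightarrow> 'l) \<Rightarrow> ('l list \<Rightarrow> int) \<Rightarrow> nat \<Rightarrow> (nat \<Rightarrow> nat) list \<Rightarrow> int" where
  "zero_divisor lab \<Omega> j vs = pullback_cochain lab \<Omega> (4 * j) vs - pullback_cochain lab \<Omega> (4 * j + 2) vs"

text \<open>Vanishing on triangles with two equal neighbouring vertices. Such triangles arise when a
  prism is taken in a direction that the cochain does not see.\<close>

definition normalized :: "('l list \<Rightarrow> int) \<Rightarrow> bool" where
  "normalized \<Omega> \<longleftrightarrow> (\<forall>a b. \<Omega> [a, a, b] = 0 \<and> \<Omega> [a, b, b] = 0)"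

lemma normalized_pullback_cochain: "normalized \<Omega> \<Longrightarrow> pullback_cochain lab \<Omega> c [u, u, v] = 0 \<and> pullback_cochain lab \<Omega> c [u, v, v] = 0"
  by (simp add: normalized_def pullback_cochain_def)

lemma circle_integral_pullback_cochain:
  "circle_integral N c (circle_integral N (Suc c) (pullback_cochain lab \<Omega> c)) [v] = lattice_degree N lab \<Omega>"
  by (simp add: circle_integral_def pullback_cochain_def lattice_degree_def sum_subtractf)

text \<open>Of the four terms in the expanded square only the two mixed ones survive. For a pure
  term there are four edges and at most two of them are nondegenerate in its own coordinates, spread
  so that both triangles cannot be nondegenerate. Each mixed term contributes minus the degree times
  the remaining factor.\<close>

lemma circle_integral_zero_divisor_square:
  assumes "normalized \<Omega>"
  shows "circle_integral N (4 * j + 2) (circle_integral N (4 * j + 3)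
      (cup 2 (zero_divisor lab \<Omega> j) (zero_divisor lab \<Omega> j))) [u, v, w]
    = - 2 * lattice_degree N lab \<Omega> * pullback_cochain lab \<Omega> (4 * j) [u, v, w]"
proof -
  have z: "\<Omega> [a, a, b] = 0" "\<Omega> [a, b, b] = 0" for a b
    using assms by (auto simp: normalized_def)
  have 3: "4 * j + 3 = Suc (4 * j + 2)" by simp
  show ?thesis
    unfolding 3
    apply (simp add: circle_integral_def cup_def zero_divisor_def pullback_cochain_def z numeral_2_eq_2)
    apply (simp add: lattice_degree_def sum_distrib_left sum_distrib_right sum_subtractf algebra_simps sum.distrib)
    done
qed

lemma torus_integral_Suc4:
  "torus_integral N (4 * Suc j) \<phi> = torus_integral N (4 * j)
     (circle_integral N (4 * j) (circle_integral N (4 * j + 1)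
       (circle_integral N (4 * j + 2) (circle_integral N (4 * j + 3) \<phi>))))"
proof -
  have "4 * Suc j = Suc (Suc (Suc (Suc (4 * j))))" by simp
  then show ?thesis by (simp add: eval_nat_numeral)
qed

text \<open>Invariance under this projection expresses that a cochain depends on the first
  \<open>d\<close> coordinates only.\<close>

definition truncate_coords :: "nat \<Rightarrow> (nat \<Rightarrow> nat) \<Rightarrow> nat \<Rightarrow> nat" where
  "truncate_coords d v = (\<lambda>c. if c < d then v c else 0)"

lemma cup_prod_map:
  assumes "\<And>i vs. i < k \<Longrightarrow> a i (map h vs) = a i vs"
  shows "cup_prod a k (map h vs) = cup_prod a k vs"
  using assms by (induction k arbitrary: vs) (auto simp: cup_def take_map drop_map)

text \<open>Successive triangles of the product share one vertex, so every pair of neighbouring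
  vertices belongs to exactly one of them, and a repeated vertex kills that factor.\<close>

lemma cup_prod_degenerate:
  assumes "\<And>i u v. i < k \<Longrightarrow> a i [u, u, v] = 0 \<and> a i [u, v, v] = 0"
    and "length us + length ws + 2 = 2 * k + 1"
  shows "cup_prod a k (us @ v # v # ws) = 0"
  using assms
proof (induction k arbitrary: ws)
  case (Suc k)
  consider "length us + 2 \<le> 2 * k + 1" | "length us = 2 * k" | "length us = 2 * k + 1"
    using Suc.prems(2) by fastforce
  then show ?case
  proof cases
    case 1
    have eq: "take (Suc (2 * k)) (us @ v # v # ws) = us @ v # v # take (2 * k - Suc (length us)) ws"
      using 1 by (simp add: take_Cons' Suc_diff_le)
    have "cup_prod a k (us @ v # v # take (2 * k - Suc (length us)) ws) = 0"
      by (rule Suc.IH) (use Suc.prems 1 in auto)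
    then show ?thesis by (simp only: cup_prod.simps cup_def eq mult_zero_left)
  next
    case 2
    then obtain x where "ws = [x]"
      using Suc.prems(2) by (auto simp: length_Suc_conv)
    then show ?thesis using 2 Suc.prems(1)[of k] by (simp add: cup_def)
  next
    case 3
    then have "ws = []" using Suc.prems(2) by simp
    moreover obtain us' x where us: "us = us' @ [x]" "length us' = 2 * k"
      using 3 by (cases us rule: rev_cases) auto
    ultimately show ?thesis using Suc.prems(1)[of k] by (simp add: cup_def)
  qed
qed simp

text \<open>Projection formula: a front factor that does not involve coordinate \<open>c\<close>
  comes out of the integral, without sign because its degree is even.\<close>

lemma circle_integral_cup:
  assumes "\<And>us t. length us = Suc p \<Longrightarrow> \<alpha> (map (\<lambda>v. v(c := t)) us) = \<alpha> us"
    and "\<And>us v ws t. length us + length ws + 2 = Suc p \<Longrightarrow>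
      \<alpha> (map (\<lambda>v. v(c := t)) us @ v(c := t) # v(c := Suc t) # map (\<lambda>v. v(c := Suc t)) ws) = 0"
    and "length vs \<ge> Suc p" "even p"
  shows "circle_integral N c (cup p \<alpha> \<beta>) vs = cup p \<alpha> (circle_integral N c \<beta>) vs"
proof -
  have "prism (\<lambda>v. v(c := t)) (\<lambda>v. v(c := Suc t)) (cup p \<alpha> \<beta>) vs =
      (- 1) ^ p * cup p \<alpha> (prism (\<lambda>v. v(c := t)) (\<lambda>v. v(c := Suc t)) \<beta>) vs" for t
    by (intro prism_cup_left assms)
  then show ?thesis
    using assms(4) by (simp add: circle_integral_def cup_def sum_distrib_left)
qed

text \<open>Induction over the blocks of four coordinates. The first \<open>2 * j\<close> factors do
  not involve the last block and come out of its four integrals. The last square yields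
  \<open>- 2 * D\<close> times a pullback from integration over the second 2-torus, and another
  \<open>D\<close> from the first one.\<close>

lemma torus_integral_zero_divisor_power:
  assumes "normalized \<Omega>"
  shows "torus_integral N (4 * m) (cup_prod (\<lambda>i. zero_divisor lab \<Omega> (i div 2)) (2 * m)) [u] =
    (- 2 * (lattice_degree N lab \<Omega>)\<^sup>2) ^ m"
proof (induction m)
  case (Suc j)
  define z where "z = zero_divisor lab \<Omega>"
  define A where "A = cup_prod (\<lambda>i. z (i div 2)) (2 * j)"
  define D where "D = lattice_degree N lab \<Omega>"
  define B where "B = cup 2 (z j) (z j)"
  let ?p = "4 * j"
  have A_low: "A (map (truncate_coords (4 * j)) vs) = A vs" for vs
    unfolding A_def
  proof (intro cup_prod_map)
    fix i and vs :: "(nat \<Rightarrow> nat) list" assume "i < 2 * j"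
    then have "4 * (i div 2) + 3 < 4 * j" by presburger
    then show "z (i div 2) (map (truncate_coords (4 * j)) vs) = z (i div 2) vs"
      by (simp add: z_def zero_divisor_def pullback_cochain_def truncate_coords_def comp_def)
  qed
  have A1: "A (map (\<lambda>v. v(c := t)) us) = A us" if "c \<ge> 4 * j" for us c t
  proof -
    have "truncate_coords (4 * j) (v(c := t)) = truncate_coords (4 * j) v" for v
      using that by (auto simp: truncate_coords_def)
    then have "map (truncate_coords (4 * j)) (map (\<lambda>v. v(c := t)) us) = map (truncate_coords (4 * j)) us" by simp
    then show ?thesis by (metis A_low)
  qed
  have A2: "A (map (\<lambda>v. v(c := t)) us @ v(c := t) # v(c := Suc t) # map (\<lambda>v. v(c := Suc t)) ws) = 0"
    if "c \<ge> 4 * j" "length us + length ws + 2 = Suc ?p" for us c t v ws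
  proof -
    have l: "truncate_coords (4 * j) (v(c := t)) = truncate_coords (4 * j) v" for v t
      using that by (auto simp: truncate_coords_def)
    have "A (map (truncate_coords (4 * j)) us @ truncate_coords (4 * j) v # truncate_coords (4 * j) v # map (truncate_coords (4 * j)) ws) = 0"
      unfolding A_def
      by (intro cup_prod_degenerate)
        (use assms that in \<open>auto simp: z_def zero_divisor_def normalized_pullback_cochain\<close>)
    then show ?thesis
      by (subst A_low[symmetric]) (simp add: l comp_def)
  qed
  have step: "circle_integral N c (cup ?p A \<beta>) vs = cup ?p A (circle_integral N c \<beta>) vs"
    if "c \<ge> 4 * j" "length vs \<ge> Suc ?p" for c \<beta> vs
    by (rule circle_integral_cup) (use that A1 A2 in auto)
  have eq: "cup_prod (\<lambda>i. z (i div 2)) (2 * Suc j) = cup ?p A B"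
    by (simp add: A_def B_def cup_def fun_eq_iff take_drop numeral_3_eq_3)
  let ?P = "\<lambda>c. circle_integral N c"
  have 4: "?P (?p + 3) (cup ?p A B) vs = cup ?p A (?P (?p + 3) B) vs" if "length vs \<ge> Suc ?p" for vs
    by (rule step) (use that in auto)
  have 3: "?P (?p + 2) (?P (?p + 3) (cup ?p A B)) vs = cup ?p A (?P (?p + 2) (?P (?p + 3) B)) vs"
    if "length vs \<ge> Suc ?p" for vs
    using circle_integral_cong[of vs, OF 4] step[of "?p + 2" vs] that by simp
  have 2: "?P (?p + 1) (?P (?p + 2) (?P (?p + 3) (cup ?p A B))) vs =
      cup ?p A (?P (?p + 1) (?P (?p + 2) (?P (?p + 3) B))) vs"
    if "length vs \<ge> Suc ?p" for vs
    using circle_integral_cong[of vs, OF 3] step[of "?p + 1" vs] that by simp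
  have 1: "?P ?p (?P (?p + 1) (?P (?p + 2) (?P (?p + 3) (cup ?p A B)))) vs =
      cup ?p A (?P ?p (?P (?p + 1) (?P (?p + 2) (?P (?p + 3) B)))) vs"
    if "length vs \<ge> Suc ?p" for vs
    using circle_integral_cong[of vs, OF 2] step[of ?p vs] that by simp
  have B: "?P ?p (?P (?p + 1) (?P (?p + 2) (?P (?p + 3) B))) [v] = - 2 * D\<^sup>2" for v
  proof -
    have "?P (?p + 2) (?P (?p + 3) B) ws = (- 2 * D) * pullback_cochain lab \<Omega> ?p ws" if len: "length ws = 3" for ws
    proof -
      obtain x y y' where "ws = [x, y, y']" using len by (auto simp: length_Suc_conv numeral_3_eq_3)
      then show ?thesis
        using circle_integral_zero_divisor_square[OF assms, of N j lab x y y']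
        by (simp add: B_def z_def D_def)
    qed
    note e1 = this
    have e2: "?P (?p + 1) (?P (?p + 2) (?P (?p + 3) B)) ws =
        (- 2 * D) * ?P (?p + 1) (pullback_cochain lab \<Omega> ?p) ws" if "length ws = 2" for ws
      by (subst circle_integral_cmult[symmetric], rule circle_integral_cong, rule e1) (use that in simp)
    have "?P ?p (?P (?p + 1) (?P (?p + 2) (?P (?p + 3) B))) [v] =
        (- 2 * D) * ?P ?p (?P (?p + 1) (pullback_cochain lab \<Omega> ?p)) [v]"
      by (subst circle_integral_cmult[symmetric], rule circle_integral_cong, rule e2) simp
    then show ?thesis
      by (simp add: circle_integral_pullback_cochain D_def power2_eq_square)
  qed
  have "torus_integral N (4 * Suc j) (cup ?p A B) [u] =
      torus_integral N (4 * j) (\<lambda>vs. (- 2 * D\<^sup>2) * A vs) [u]"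
    unfolding torus_integral_Suc4
  proof (rule torus_integral_cong)
    fix vs :: "(nat \<Rightarrow> nat) list" assume "length vs = 4 * j + 1"
    moreover from this have "drop (4 * j) vs = [vs ! (4 * j)]"
      by (metis Cons_nth_drop_Suc Suc_eq_plus1 drop_all le_refl lessI)
    ultimately show "?P ?p (?P (?p + 1) (?P (?p + 2) (?P (?p + 3) (cup ?p A B)))) vs = (- 2 * D\<^sup>2) * A vs"
      using 1[of vs] B by (simp add: cup_def)
  qed simp
  also have "\<dots> = (- 2 * D\<^sup>2) * torus_integral N (4 * j) A [u]"
    by (rule torus_integral_cmult)
  also have "torus_integral N (4 * j) A [u] = (- 2 * D\<^sup>2) ^ j"
    using Suc.IH by (simp add: A_def z_def D_def)
  finally show ?case by (simp only: eq[unfolded z_def] D_def power_Suc)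
qed simp

text \<open>Changing the \<open>i\<close>-th factor by the coboundary of \<open>\<eta> i\<close>
  makes the product of all factors vanish in every cube, because some factor vanishes there. The
  original product is therefore exact and has integral 0, against the value just computed. Each zero
  divisor occurs twice, for two consecutive \<open>i\<close>.\<close>

theorem no_lattice_trivialization:
  fixes lab :: "nat \<Rightarrow> nat \<Rightarrow> 'l"
  assumes \<Omega>: "normalized \<Omega>" and deg: "lattice_degree N lab \<Omega> \<noteq> 0"
    and lab: "\<And>t. lab N t = lab 0 t" "\<And>s. lab s N = lab s 0"
    and closed: "\<And>j vs w. j < m \<Longrightarrow> length vs = 4 \<Longrightarrow> \<forall>c<4 * m. w c < N \<Longrightarrow> in_cell (4 * m) w vs \<Longrightarrow>
      coboundary (zero_divisor lab \<Omega> j) vs = 0"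
    and \<eta>: "\<And>i. i < 2 * m \<Longrightarrow> periodic N (4 * m) (\<eta> i)"
    and triv: "\<And>w. \<forall>c<4 * m. w c < N \<Longrightarrow> \<exists>i<2 * m. \<forall>vs. length vs = 3 \<longrightarrow> in_cell (4 * m) w vs \<longrightarrow>
      zero_divisor lab \<Omega> (i div 2) vs + coboundary (\<eta> i) vs = 0"
    and N: "N > 0"
  shows False
proof (cases "m = 0")
  case True
  then show ?thesis using triv[of "\<lambda>_. 0"] by simp
next
  case False
  let ?a = "\<lambda>i. zero_divisor lab \<Omega> (i div 2)"
  have "periodic N (4 * m) (pullback_cochain lab \<Omega> c)" for c
    unfolding periodic_def pullback_cochain_def map_map comp_def
    by (intro allI impI arg_cong[where f = \<Omega>] map_cong) (auto simp: lab)
  then have per: "periodic N (4 * m) (?a i)" for i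
    by (simp add: periodic_def zero_divisor_def)
  have "\<exists>\<xi>. periodic N (4 * m) \<xi> \<and>
    (\<forall>vs w. length vs = 2 * (2 * m) + 1 \<longrightarrow> (\<forall>c<4 * m. w c < N) \<longrightarrow> in_cell (4 * m) w vs \<longrightarrow>
      cup_prod (\<lambda>i vs. ?a i vs + coboundary (\<eta> i) vs) (2 * m) vs =
      cup_prod ?a (2 * m) vs + coboundary \<xi> vs)"
    by (rule cup_prod_cohomologous) (use closed \<eta> per in auto)
  then obtain \<xi> where \<xi>: "periodic N (4 * m) \<xi>"
    "\<And>vs w. length vs = 2 * (2 * m) + 1 \<Longrightarrow> \<forall>c<4 * m. w c < N \<Longrightarrow> in_cell (4 * m) w vs \<Longrightarrow>
      cup_prod (\<lambda>i vs. ?a i vs + coboundary (\<eta> i) vs) (2 * m) vs =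
      cup_prod ?a (2 * m) vs + coboundary \<xi> vs" by blast
  let ?u = "\<lambda>_. 0 :: nat"
  have "torus_integral N (4 * m) (cup_prod ?a (2 * m)) [?u] =
      torus_integral N (4 * m) (\<lambda>vs. - coboundary \<xi> vs) [?u]"
  proof (rule torus_integral_cong)
    fix vs w assume vs: "length vs = 4 * m + 1" "\<forall>c<4 * m. w c < N" "in_cell (4 * m) w vs"
    obtain i where "i < 2 * m" and i: "\<And>ws. length ws = 3 \<Longrightarrow> in_cell (4 * m) w ws \<Longrightarrow>
        ?a i ws + coboundary (\<eta> i) ws = 0"
      using triv[OF vs(2)] by blast
    have "cup_prod (\<lambda>i vs. ?a i vs + coboundary (\<eta> i) vs) (2 * m) vs = 0"
      by (rule cup_prod_eq_0[where i = i])
        (use vs \<open>i < 2 * m\<close> i in_cell_subset in \<open>auto simp: mult.assoc\<close>)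
    then show "cup_prod ?a (2 * m) vs = - coboundary \<xi> vs"
      using \<xi>(2)[of vs w] vs by simp
  qed simp
  also have "\<dots> = 0"
    using torus_integral_exact[OF \<xi>(1)] False by (simp add: torus_integral_minus)
  finally show False
    using torus_integral_zero_divisor_power[OF \<Omega>] deg by simp
qed

subsection \<open>The fundamental cocycle of punctured space\<close>

text \<open>Label 0 is the nonpositive octant; elsewhere the label is the index of a largest
  coordinate, which is then positive, with ties going to the smaller index.\<close>

definition label :: "real ^ 3 \<Rightarrow> nat" where
  "label x =
     (if x $ 1 \<le> 0 \<and> x $ 2 \<le> 0 \<and> x $ 3 \<le> 0 then 0
      else if x $ 2 \<le> x $ 1 \<and> x $ 3 \<le> x $ 1 then 1
      else if x $ 3 \<le> x $ 2 then 2 else 3)"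

text \<open>The alternating cochain dual to the face 123 of a tetrahedron with vertices 0, 1, 2, 3.
  It generates the second cohomology of the boundary sphere.\<close>

definition orientation :: "nat list \<Rightarrow> int" where
  "orientation ls =
     (if ls \<in> {[1, 2, 3], [2, 3, 1], [3, 1, 2]} then 1
      else if ls \<in> {[2, 1, 3], [1, 3, 2], [3, 2, 1]} then - 1 else 0)"

lemma label_in: "label x \<in> {0, 1, 2, 3}"
  by (simp add: label_def)

lemma label_scaleR: "a > 0 \<Longrightarrow> label (a *\<^sub>R x) = label x"
  by (simp add: label_def mult_le_0_iff)

lemma normalized_orientation: "normalized orientation"
  by (simp add: normalized_def orientation_def)

lemma orientation_nonzero: "orientation ls \<noteq> 0 \<Longrightarrow> {1, 2, 3} \<subseteq> set ls"
  by (auto simp: orientation_def split: if_splits)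

text \<open>The boundary of the tetrahedron has no simplex with all four vertices, so only
  degenerate cases are left, which are checked one by one.\<close>

lemma coboundary_orientation:
  assumes "length ls = 4" "set ls \<subseteq> {0, 1, 2, 3}" "\<not> {0, 1, 2, 3} \<subseteq> set ls"
  shows "coboundary orientation ls = 0"
proof -
  obtain a b c d where ls: "ls = [a, b, c, d]"
    using assms(1) by (auto simp: length_Suc_conv eval_nat_numeral)
  have a: "a = 0 \<or> a = 1 \<or> a = 2 \<or> a = 3" and b: "b = 0 \<or> b = 1 \<or> b = 2 \<or> b = 3"
    and c: "c = 0 \<or> c = 1 \<or> c = 2 \<or> c = 3" and d: "d = 0 \<or> d = 1 \<or> d = 2 \<or> d = 3"
    using assms(2) by (auto simp: ls)
  show ?thesis
    using a b c d assms(3) unfolding ls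
    by (elim disjE; simp add: orientation_def)
qed

text \<open>A point labelled 0 has coordinates at most 0, while a point labelled \<open>k\<close>
  has \<open>k\<close>-th coordinate at least 0. If all labels occurred among points closer than
  \<open>e\<close>, the former would have three coordinates smaller than \<open>e\<close> in
  absolute value, hence norm less than \<open>3 * e\<close>.\<close>

lemma label_not_surj:
  assumes "\<And>x. x \<in> X \<Longrightarrow> 3 * e \<le> norm x" and "\<And>x y. x \<in> X \<Longrightarrow> y \<in> X \<Longrightarrow> dist x y < e"
  shows "\<not> {0, 1, 2, 3} \<subseteq> label ` X"
proof
  assume *: "{0, 1, 2, 3} \<subseteq> label ` X"
  obtain p0 p1 p2 p3 where p: "p0 \<in> X" "label p0 = 0" "p1 \<in> X" "label p1 = 1"
     "p2 \<in> X" "label p2 = 2" "p3 \<in> X" "label p3 = 3"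
    using * by (auto simp: image_iff subset_iff) metis
  have neg: "p0 $ 1 \<le> 0" "p0 $ 2 \<le> 0" "p0 $ 3 \<le> 0"
    using p(2) by (auto simp: label_def split: if_splits)
  have pos: "p1 $ 1 \<ge> 0" "p2 $ 2 \<ge> 0" "p3 $ 3 \<ge> 0"
    using p(4,6,8) by (auto simp: label_def split: if_splits)
  have "\<bar>p0 $ k - q $ k\<bar> < e" if "q \<in> X" for q k
    using component_le_norm_cart[of "p0 - q" k] assms(2)[OF p(1) that] by (simp add: dist_norm)
  from this[OF p(3), of 1] this[OF p(5), of 2] this[OF p(7), of 3]
  have "\<bar>p0 $ 1\<bar> < e" "\<bar>p0 $ 2\<bar> < e" "\<bar>p0 $ 3\<bar> < e" using neg pos by linarith+
  moreover have "norm p0 \<le> \<bar>p0 $ 1\<bar> + \<bar>p0 $ 2\<bar> + \<bar>p0 $ 3\<bar>"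
    using norm_le_l1_cart[of p0] by (simp add: sum_3)
  ultimately show False using assms(1)[OF p(1)] by linarith
qed

text \<open>By compactness \<open>f\<close> stays away from 0 and is uniformly continuous, so sets
  of small diameter have images to which the previous lemma applies.\<close>

lemma eventually_label_not_surj:
  fixes f :: "'a::metric_space \<Rightarrow> real ^ 3"
  assumes "compact S" "continuous_on S f" "0 \<notin> f ` S"
  shows "\<forall>\<^sub>F \<delta> in at_right 0. \<forall>X\<subseteq>S. (\<forall>x\<in>X. \<forall>y\<in>X. dist x y < \<delta>) \<longrightarrow> \<not> {0, 1, 2, 3} \<subseteq> label ` f ` X"
proof -
  have "compact (f ` S)" using assms by (intro compact_continuous_image)
  then have "open (- (f ` S))" by (simp add: compact_imp_closed open_Compl)
  then obtain e where e: "e > 0" "ball 0 e \<subseteq> - (f ` S)"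
    using assms(3) openE by blast
  have norm: "e \<le> norm (f x)" if "x \<in> S" for x
    using e(2) that by (force simp: subset_iff)
  have "uniformly_continuous_on S f"
    using assms by (simp add: compact_uniformly_continuous)
  then obtain d where d: "d > 0" "\<And>x y. x \<in> S \<Longrightarrow> y \<in> S \<Longrightarrow> dist x y < d \<Longrightarrow> dist (f x) (f y) < e / 3"
    unfolding uniformly_continuous_on_def using e(1) by (metis divide_pos_pos zero_less_numeral dist_commute)
  have "\<not> {0, 1, 2, 3} \<subseteq> label ` f ` X"
    if "\<delta> < d" "X \<subseteq> S" "\<forall>x\<in>X. \<forall>y\<in>X. dist x y < \<delta>" for \<delta> X
  proof (rule label_not_surj)
    show "3 * (e / 3) \<le> norm x" if "x \<in> f ` X" for x
      using that norm \<open>X \<subseteq> S\<close> by auto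
    have "dist x y < d" if "x \<in> X" "y \<in> X" for x y
      using that \<open>\<delta> < d\<close> \<open>\<forall>x\<in>X. _ x\<close> by (meson less_trans)
    then have "dist (f x) (f y) < e / 3" if "x \<in> X" "y \<in> X" for x y
      using that \<open>X \<subseteq> S\<close> by (intro d(2)) auto
    then show "dist x y < e / 3" if "x \<in> f ` X" "y \<in> f ` X" for x y
      using that by blast
  qed
  moreover have "\<forall>\<^sub>F \<delta> in at_right 0. \<delta> < d"
    using d(1) by (simp add: eventually_at_right_less order_tendstoD(2)[OF tendsto_ident_at])
  ultimately show ?thesis by (auto elim!: eventually_mono)
qed

text \<open>The map \<open>wrap\<close> collapses the boundary of the unit square into the cone labelled 0, and the cones
  labelled 1, 2, 3 meet only at the image of the centre: it has degree \<open>\<plusminus>1\<close>.\<close>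

definition bump :: "real \<Rightarrow> real \<Rightarrow> real" where
  "bump s t = 32 * (s * (1 - s)) * (t * (1 - t)) - 1"

text \<open>Its zeros are 0, 1/2 and 1; it is negative on the first half of the interval and
  positive on the second.\<close>

definition wave :: "real \<Rightarrow> real" where
  "wave s = s * (1 - s) * (2 * s - 1)"

definition wrap :: "real \<Rightarrow> real \<Rightarrow> real ^ 3" where
  "wrap s t = vector [bump s t, bump s t + wave s, bump s t + wave t]"

lemma wrap_nth [simp]:
  "wrap s t $ 1 = bump s t" "wrap s t $ 2 = bump s t + wave s" "wrap s t $ 3 = bump s t + wave t"
  by (simp_all add: wrap_def)

text \<open>If both waves vanish, the parameters are 0, 1/2 or 1. There \<open>bump\<close> is -1
  except at the centre, where the factor 32 makes it 1.\<close>

lemma wrap_nonzero: "wrap s t \<noteq> 0"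
proof
  assume "wrap s t = 0"
  then have *: "bump s t = 0" "wave s = 0" "wave t = 0"
    using wrap_nth[of s t] by simp_all
  have cases: "s = 0 \<or> s = 1 \<or> s = 1 / 2" if "wave s = 0" for s
    using that unfolding wave_def mult_eq_0_iff by linarith
  show False using cases[OF *(2)] cases[OF *(3)] *(1)
    by (elim disjE) (simp_all add: bump_def)
qed

lemma continuous_on_wrap:
  assumes "continuous_on S f" "continuous_on S g"
  shows "continuous_on S (\<lambda>x. wrap (f x) (g x))"
proof -
  have "continuous_on S (\<lambda>x. wrap (f x) (g x) $ i)" for i
  proof -
    have "continuous_on S (\<lambda>x. bump (f x) (g x))" "continuous_on S (\<lambda>x. wave (f x))"
      "continuous_on S (\<lambda>x. wave (g x))"
      unfolding bump_def wave_def by (intro continuous_intros assms)+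
    then show ?thesis using exhaust_3[of i] by (elim disjE; simp add: continuous_on_add)
  qed
  then show ?thesis
    by (simp add: continuous_on_vec_lambda[of S "\<lambda>i x. wrap (f x) (g x) $ i", simplified])
qed

lemma wrap_periodic [simp]: "wrap 1 t = wrap 0 t" "wrap s 1 = wrap s 0"
  by (simp_all add: wrap_def bump_def wave_def)

lemma wave_le_1: "0 \<le> s \<Longrightarrow> s \<le> 1 \<Longrightarrow> wave s \<le> 1"
proof -
  assume s: "0 \<le> s" "s \<le> 1"
  have "s * (1 - s) \<le> 1 * 1" using s by (intro mult_mono) auto
  moreover have "0 \<le> s * (1 - s)" using s by simp
  moreover have "2 * s - 1 \<le> 1" using s by simp
  ultimately show ?thesis unfolding wave_def
    using mult_left_mono[of "2 * s - 1" 1 "s * (1 - s)"] by linarith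
qed

lemma wave_nonpos: "0 \<le> s \<Longrightarrow> s \<le> 1 / 2 \<Longrightarrow> wave s \<le> 0"
  by (simp add: wave_def mult_nonneg_nonpos)

lemma wave_pos: "1 / 2 < s \<Longrightarrow> s < 1 \<Longrightarrow> wave s > 0"
  by (simp add: wave_def)

lemma label_wrap_boundary:
  assumes "0 \<le> s" "s \<le> 1" "0 \<le> t" "t \<le> 1" "s = 1 \<or> t = 1"
  shows "label (wrap s t) = 0"
proof -
  have "bump s t = - 1" using assms(5) by (auto simp: bump_def)
  then show ?thesis using wave_le_1[of s] wave_le_1[of t] assms by (simp add: label_def)
qed

lemma label_wrap_1: "label (wrap s t) = 1 \<Longrightarrow> wave s \<le> 0 \<and> wave t \<le> 0"
  and label_wrap_2: "label (wrap s t) = 2 \<Longrightarrow> wave s > 0"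
  and label_wrap_3: "label (wrap s t) = 3 \<Longrightarrow> wave t > 0"
  by (auto simp: label_def split: if_splits)

text \<open>Label 1 needs both indices at most \<open>K\<close>, label 2 the first index above
  \<open>K\<close>, label 3 the second index above \<open>K\<close>. A triangle with all three
  labels thus lies in the square with lower corner \<open>(K, K)\<close>, and one of the two
  triangles there has labels 1, 3, 2.\<close>

lemma lattice_degree_wrap:
  assumes "K \<ge> 2"
  shows "lattice_degree (2 * K) (\<lambda>i j. label (wrap (real i / real (2 * K)) (real j / real (2 * K)))) orientation = - 1"
proof -
  define N where "N = 2 * K"
  define x where "x i = real i / real N" for i :: nat
  define lab where "lab i j = label (wrap (x i) (x j))" for i j
  have N: "N > 0" using assms by (simp add: N_def)
  have x: "0 \<le> x i" "x i \<le> 1" if "i \<le> N" for i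
    using that N by (auto simp: x_def)
  have low: "wave (x i) \<le> 0" if "i \<le> K" for i
    by (rule wave_nonpos) (use that assms in \<open>auto simp: x_def N_def field_simps\<close>)
  have high: "wave (x i) > 0" if "K < i" "i < N" for i
    by (rule wave_pos) (use that assms in \<open>auto simp: x_def N_def field_simps\<close>)
  have boundary: "lab i j = 0" if "i = N \<or> j = N" "i \<le> N" "j \<le> N" for i j
    unfolding lab_def by (rule label_wrap_boundary) (use that N x in \<open>auto simp: x_def\<close>)
  have zero: "orientation [lab i j, lab i' j', lab (Suc i) (Suc j)] = 0"
    if "i < N" "j < N" "i' \<in> {i, Suc i}" "j' \<in> {j, Suc j}" "(i, j) \<noteq> (K, K)" for i j i' j'
  proof (rule ccontr)
    let ?V = "{(i, j), (i', j'), (Suc i, Suc j)}"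
    assume nz: "orientation [lab i j, lab i' j', lab (Suc i) (Suc j)] \<noteq> 0"
    then have sub: "{1, 2, 3} \<subseteq> (\<lambda>(a, b). lab a b) ` ?V"
      using orientation_nonzero by force
    \<comment> \<open>The far boundary carries label 0, so the square stays away from index
      \<open>N\<close>, where \<open>wave\<close> vanishes again and \<open>high\<close>
      fails.\<close>
    have "lab (Suc i) (Suc j) \<noteq> 0"
      using nz by (auto simp: orientation_def split: if_splits)
    then have "Suc i \<noteq> N" "Suc j \<noteq> N"
      using boundary[of "Suc i" "Suc j"] that(1,2) by auto
    then have ij: "Suc i < N" "Suc j < N" using that(1,2) by auto
    have V: "a \<in> {i, Suc i} \<and> b \<in> {j, Suc j} \<and> a < N \<and> b < N" if "(a, b) \<in> ?V" for a b
      using that \<open>i' \<in> _\<close> \<open>j' \<in> _\<close> ij by auto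
    obtain a1 b1 where 1: "(a1, b1) \<in> ?V" "lab a1 b1 = 1" using sub by (force simp: image_iff)
    obtain a2 b2 where 2: "(a2, b2) \<in> ?V" "lab a2 b2 = 2" using sub by (force simp: image_iff)
    obtain a3 b3 where 3: "(a3, b3) \<in> ?V" "lab a3 b3 = 3" using sub by (force simp: image_iff)
    have "a1 \<le> K" "b1 \<le> K"
      using label_wrap_1 1(2) high[of a1] high[of b1] V[OF 1(1)] unfolding lab_def by force+
    moreover have "a2 > K" using label_wrap_2 2(2) low[of a2] unfolding lab_def by force
    moreover have "b3 > K" using label_wrap_3 3(2) low[of b3] unfolding lab_def by force
    ultimately show False
      using V[OF 1(1)] V[OF 2(1)] V[OF 3(1)] that(5) by auto
  qed
  have xK: "x K = 1 / 2" using assms by (simp add: x_def N_def)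
  have xSK: "x (Suc K) * (1 - x (Suc K)) = (1 - 1 / (real K)\<^sup>2) / 4"
    using assms by (simp add: x_def N_def field_simps power2_eq_square)
  have wK: "wave (x K) = 0" by (simp add: wave_def xK)
  have wSK: "wave (x (Suc K)) > 0" by (rule high) (use assms in \<open>auto simp: N_def\<close>)
  \<comment> \<open>The bound 3/16 is the value at \<open>K = 2\<close>; it suffices because 32
    times its square exceeds 1.\<close>
  have q: "x (Suc K) * (1 - x (Suc K)) \<ge> 3 / 16"
  proof -
    have "(real K)\<^sup>2 \<ge> 2\<^sup>2" using assms by (intro power_mono) auto
    then have "1 / (real K)\<^sup>2 \<le> 1 / 4" by (intro frac_le) auto
    then show ?thesis unfolding xSK by simp
  qed
  have b: "bump (x a) (x b) > 0" if "a \<in> {K, Suc K}" "b \<in> {K, Suc K}" for a b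
  proof -
    have *: "32 * p * q - 1 > 0" if "p \<ge> 3 / 16" "q \<ge> 3 / 16" for p q :: real
    proof -
      have "3 / 16 * (3 / 16) \<le> p * q" using that by (intro mult_mono) auto
      then show ?thesis unfolding mult.assoc by linarith
    qed
    show ?thesis unfolding bump_def by (rule *) (use that q in \<open>auto simp: xK\<close>)
  qed
  have labK: "lab K K = 1" "lab K (Suc K) = 3" "lab (Suc K) K = 2" "lab (Suc K) (Suc K) = 2"
    using b[of K K] b[of K "Suc K"] b[of "Suc K" K] b[of "Suc K" "Suc K"] wSK
    by (auto simp: lab_def label_def wK)
  let ?T = "\<lambda>s t. orientation [lab s t, lab s (Suc t), lab (Suc s) (Suc t)] -
      orientation [lab s t, lab (Suc s) t, lab (Suc s) (Suc t)]"
  have T: "?T s t = (if s = K then if t = K then - 1 else 0 else 0)" if "s < N" "t < N" for s t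
  proof (cases "s = K \<and> t = K")
    case True
    then show ?thesis by (simp add: labK) (simp add: orientation_def)
  next
    case False
    then show ?thesis using zero[of s t s "Suc t"] zero[of s t "Suc s" t] that by auto
  qed
  have "lattice_degree N lab orientation = (\<Sum>s<N. \<Sum>t<N. if s = K then if t = K then - 1 else 0 else 0)"
    unfolding lattice_degree_def by (intro sum.cong refl T) auto
  also have "\<dots> = (\<Sum>s<N. if s = K then - 1 else 0)"
    using assms by (intro sum.cong refl) (auto simp: N_def)
  also have "\<dots> = - 1" using assms by (simp add: N_def)
  finally show ?thesis by (simp add: lab_def [abs_def] x_def N_def)
qed

subsection \<open>Motion planners as homotopies\<close>

text \<open>Evaluation is jointly continuous because the interval is locally compact: a compact
  neighbourhood \<open>K\<close> of \<open>t\<close> that the path maps into \<open>W\<close> gives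
  a subbasic open set of paths.\<close>

lemma continuous_map_eval_path_space:
  assumes s: "continuous_map Z (path_space Y) s"
  shows "continuous_map (prod_topology (top_of_set {0..1::real}) Z) Y (\<lambda>(t, z). s z t)"
proof -
  have path: "continuous_map (top_of_set {0..1}) Y (s z)" if "z \<in> topspace Z" for z
    using continuous_map_image_subset_topspace[OF s] that
    by (auto simp: path_space_def continuous_maps_def)
  have "openin (prod_topology (top_of_set {0..1}) Z)
      {p \<in> topspace (prod_topology (top_of_set {0..1}) Z). (case p of (t, z) \<Rightarrow> s z t) \<in> W}"
    if W: "openin Y W" for W
    unfolding openin_prod_topology_alt
  proof (intro allI impI)
    fix t z assume "(t, z) \<in> {p \<in> topspace (prod_topology (top_of_set {0..1}) Z). (case p of (t, z) \<Rightarrow> s z t) \<in> W}"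
    then have t: "t \<in> {0..1}" and z: "z \<in> topspace Z" and "s z t \<in> W" by auto
    have "openin (top_of_set {0..1}) {u \<in> {0..1}. s z u \<in> W}"
      using path[OF z] W unfolding continuous_map_def by auto
    then obtain e where e: "e > 0" "\<And>u. u \<in> {0..1} \<Longrightarrow> dist u t < e \<Longrightarrow> s z u \<in> W"
      using t \<open>s z t \<in> W\<close> unfolding openin_euclidean_subtopology_iff by blast
    define K where "K = cball t (e / 2) \<inter> {0..1}"
    define V where "V = {z' \<in> topspace Z. s z' \<in> {f \<in> continuous_maps (top_of_set {0..1}) Y. f ` K \<subseteq> W}}"
    have "compactin (top_of_set {0..1}) K"
      unfolding compactin_subtopology K_def by (auto intro: compact_Int_closed)
    then have "openin (path_space Y) {f \<in> continuous_maps (top_of_set {0..1}) Y. f ` K \<subseteq> W}"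
      unfolding path_space_def compact_open_topology_def using W
      by (intro topology_generated_by_Basis) blast
    then have "openin Z V"
      unfolding V_def using s by (auto simp: continuous_map_def)
    moreover have "z \<in> V"
      using z e path[OF z] continuous_map_image_subset_topspace[OF s]
      by (auto simp: V_def K_def path_space_def dist_commute)
    moreover have "openin (top_of_set {0..1}) ({0..1} \<inter> ball t (e / 2))"
      by (simp add: openin_open_Int)
    moreover have "({0..1} \<inter> ball t (e / 2)) \<times> V \<subseteq>
        {p \<in> topspace (prod_topology (top_of_set {0..1}) Z). (case p of (t, z) \<Rightarrow> s z t) \<in> W}"
      by (auto simp: V_def K_def image_subset_iff)
    ultimately show "\<exists>U V. openin (top_of_set {0..1}) U \<and> openin Z V \<and> t \<in> U \<and> z \<in> V \<and> U \<times> V \<subseteq>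
        {p \<in> topspace (prod_topology (top_of_set {0..1}) Z). (case p of (t, z) \<Rightarrow> s z t) \<in> W}"
      using t e(1) by (intro exI[of _ "{0..1} \<inter> ball t (e / 2)"] exI[of _ V]) auto
  qed
  moreover have "s z t \<in> topspace Y" if "z \<in> topspace Z" "t \<in> {0..1}" for z t
    using continuous_map_image_subset_topspace[OF path[OF that(1)]] that(2) by auto
  ultimately show ?thesis unfolding continuous_map_def by auto
qed

text \<open>The converse half of the exponential law. Preimages of subbasic sets are open by the
  tube lemma over the compact set \<open>K\<close>.\<close>

lemma continuous_map_into_path_space:
  assumes h: "continuous_map (prod_topology (top_of_set {0..1::real}) Z) Y h"
  shows "continuous_map Z (path_space Y) (\<lambda>z. \<lambda>t\<in>{0..1}. h (t, z))"
proof -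
  let ?s = "\<lambda>z. \<lambda>t\<in>{0..1}. h (t, z)"
  have maps: "?s z \<in> continuous_maps (top_of_set {0..1}) Y" if "z \<in> topspace Z" for z
  proof -
    have "continuous_map (top_of_set {0..1}) Y (h \<circ> (\<lambda>t. (t, z)))"
      by (intro continuous_map_compose[OF _ h]) (simp add: continuous_map_paired that)
    then have "continuous_map (top_of_set {0..1}) Y (?s z)"
      by (rule continuous_map_eq) auto
    then show ?thesis by (simp add: continuous_maps_def)
  qed
  have open_pre: "openin Z {z \<in> topspace Z. h ` (K \<times> {z}) \<subseteq> U}"
    if K: "compactin (top_of_set {0..1}) K" and U: "openin Y U" for K U
  proof (subst openin_subopen, intro ballI)
    fix z assume z: "z \<in> {z \<in> topspace Z. h ` (K \<times> {z}) \<subseteq> U}"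
    let ?W = "{p \<in> topspace (prod_topology (top_of_set {0..1}) Z). h p \<in> U}"
    have K01: "K \<subseteq> {0..1}" using compactin_subset_topspace[OF K] by simp
    have "openin (prod_topology (top_of_set {0..1}) Z) ?W"
      using h U by (auto simp: continuous_map_def)
    moreover have "K \<times> {z} \<subseteq> ?W" using z K01 by auto
    ultimately obtain A V where "openin Z V" "K \<subseteq> A" "z \<in> V" "A \<times> V \<subseteq> ?W"
      using tube_lemma_left[of "top_of_set {0..1}" Z ?W K z] K z by blast
    then show "\<exists>T. openin Z T \<and> z \<in> T \<and> T \<subseteq> {z \<in> topspace Z. h ` (K \<times> {z}) \<subseteq> U}"
      using openin_subset by (intro exI[of _ V]) fastforce
  qed
  show ?thesis
    unfolding path_space_def compact_open_topology_def
  proof (rule continuous_on_generated_topo)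
    fix B :: "(real \<Rightarrow> 'b) set" assume "B \<in> {{f \<in> continuous_maps (top_of_set {0..1}) Y. f ` K \<subseteq> U} |K U.
        compactin (top_of_set {0..1}) K \<and> openin Y U}"
    then obtain K U where B: "B = {f \<in> continuous_maps (top_of_set {0..1}) Y. f ` K \<subseteq> U}"
      and K: "compactin (top_of_set {0..1}) K" and U: "openin Y U" by blast
    have K01: "K \<subseteq> {0..1}" using compactin_subset_topspace[OF K] by simp
    then have "?s -` B \<inter> topspace Z = {z \<in> topspace Z. h ` (K \<times> {z}) \<subseteq> U}"
      using maps by (auto simp: B image_subset_iff subset_iff)
    then show "openin Z (?s -` B \<inter> topspace Z)" using open_pre[OF K U] by simp
  next
    have "topspace (path_space Y) = continuous_maps (top_of_set {0..1}) Y"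
      by (simp add: path_space_def)
    then show "?s ` topspace Z \<subseteq> \<Union> {{f \<in> continuous_maps (top_of_set {0..1}) Y. f ` K \<subseteq> U} |K U.
        compactin (top_of_set {0..1}) K \<and> openin Y U}"
      using maps unfolding path_space_def compact_open_topology_def topology_generated_by_topspace
      by blast
  qed
qed

text \<open>Currying turns a section over \<open>U\<close> into a homotopy between the two
  projections, so the path space can be avoided from here on.\<close>

lemma has_motion_planner_iff_homotopic:
  assumes "U \<subseteq> topspace (prod_topology X X)"
  shows "has_motion_planner X U \<longleftrightarrow>
    homotopic_with (\<lambda>_. True) (subtopology (prod_topology X X) U) X fst snd"
    (is "_ \<longleftrightarrow> homotopic_with _ ?Z X fst snd")
proof -
  have Z: "topspace ?Z = U" using assms by auto
  have iff: "homotopic_with (\<lambda>_. True) ?Z X fst snd \<longleftrightarrow>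
      (\<exists>h. continuous_map (prod_topology (top_of_set {0..1::real}) ?Z) X h \<and>
        (\<forall>z\<in>U. h (0, z) = fst z) \<and> (\<forall>z\<in>U. h (1, z) = snd z))"
    unfolding homotopic_with[of ?Z "\<lambda>_. True" X fst snd, OF refl] Z by simp
  show ?thesis
  proof
    assume "has_motion_planner X U"
    then obtain s where s: "continuous_map ?Z (path_space X) s" and e: "\<forall>z\<in>U. (s z 0, s z 1) = z"
      unfolding has_motion_planner_def path_ends_def by blast
    define h where "h = (\<lambda>(t, z). s z t)"
    have "continuous_map (prod_topology (top_of_set {0..1::real}) ?Z) X h"
      unfolding h_def by (rule continuous_map_eval_path_space[OF s])
    moreover have "\<forall>z\<in>U. h (0, z) = fst z" "\<forall>z\<in>U. h (1, z) = snd z"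
      using e by (metis h_def prod.case fst_conv snd_conv)+
    ultimately show "homotopic_with (\<lambda>_. True) ?Z X fst snd"
      unfolding iff by blast
  next
    assume "homotopic_with (\<lambda>_. True) ?Z X fst snd"
    then obtain h where h: "continuous_map (prod_topology (top_of_set {0..1::real}) ?Z) X h"
      and ends: "\<forall>z\<in>U. h (0, z) = fst z" "\<forall>z\<in>U. h (1, z) = snd z"
      unfolding iff by blast
    show "has_motion_planner X U"
      unfolding has_motion_planner_def path_ends_def
      using continuous_map_into_path_space[OF h] ends
      by (auto intro!: exI[of _ "\<lambda>z. \<lambda>t\<in>{0..1}. h (t, z)"])
  qed
qed

lemma topspace_configuration_space:
  "x \<in> topspace (configuration_space n (euclidean :: (real ^ 3) topology)) \<longleftrightarrow>
    x \<in> extensional {1..n} \<and> (\<forall>i\<in>{1..n}. \<forall>j\<in>{1..n}. i \<noteq> j \<longrightarrow> x i \<noteq> x j)"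
  by (auto simp: configuration_space_def PiE_def)

lemma continuous_map_configuration_space_nth:
  "i \<in> {1..n} \<Longrightarrow> continuous_map (configuration_space n X) X (\<lambda>x. x i)"
  unfolding configuration_space_def
  by (intro continuous_map_from_subtopology continuous_map_product_projection)

lemma continuous_map_into_configuration_space:
  "continuous_map Z (configuration_space n (euclidean :: (real ^ 3) topology)) f \<longleftrightarrow>
    (\<forall>i\<in>{1..n}. continuous_map Z euclidean (\<lambda>z. f z i)) \<and>
    (\<forall>z\<in>topspace Z. f z \<in> topspace (configuration_space n (euclidean :: (real ^ 3) topology)))"
  unfolding configuration_space_def continuous_map_in_subtopology continuous_map_componentwise
  by (auto simp: PiE_def Pi_def)

subsection \<open>The lower bound\<close>

text \<open>The metric on functions is a sum of coordinate distances, cut off at 1, with weights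
  \<open>(1 / 2) ^ n\<close>; the weights add up to 2.\<close>

lemma dist_fun_le:
  fixes x y :: "nat \<Rightarrow> real"
  assumes "\<And>i. dist (x i) (y i) \<le> e"
  shows "dist x y \<le> 2 * e"
proof -
  have e: "0 \<le> e" using assms[of 0] zero_le_dist order_trans by blast
  have s: "summable (\<lambda>n. (1 / 2 :: real) ^ n * e)"
    by (intro summable_mult2 summable_geometric) auto
  have "dist x y \<le> (\<Sum>n. (1 / 2) ^ n * e)"
    unfolding dist_fun_def
  proof (rule suminf_le)
    show le: "(1 / 2) ^ n * min (dist (x (from_nat n)) (y (from_nat n))) 1 \<le> (1 / 2) ^ n * e" for n
      by (intro mult_left_mono) (auto intro: min.coboundedI1 assms)
    show "summable (\<lambda>n. (1 / 2) ^ n * min (dist (x (from_nat n)) (y (from_nat n))) 1)"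
      by (rule summable_comparison_test'[OF s, of 0]) (use le in auto)
  qed (rule s)
  also have "\<dots> = 2 * e"
    using suminf_geometric[of "1 / 2 :: real"] by (simp add: suminf_mult2[symmetric] summable_geometric)
  finally show ?thesis .
qed

lemma dist_Pair_le: "dist (a, b) (c, d) \<le> dist a c + dist b d"
  by (simp add: dist_Pair_Pair sqrt_sum_squares_le_sum)

text \<open>Particle 1 sits at the origin and particle \<open>i\<close> on the sphere of radius
  \<open>i - 1\<close>, so collisions are impossible whatever the directions. The offset
  \<open>c\<close> is 0 for the first configuration and 2 for the second.\<close>

definition lift_conf :: "nat \<Rightarrow> nat \<Rightarrow> (nat \<Rightarrow> real) \<Rightarrow> nat \<Rightarrow> real ^ 3" where
  "lift_conf n c z = (\<lambda>i\<in>{1..n}. if i = 1 then 0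
     else real (i - 1) *\<^sub>R sgn (wrap (z (4 * (i - 2) + c)) (z (Suc (4 * (i - 2) + c)))))"

definition torus_map :: "nat \<Rightarrow> (nat \<Rightarrow> real) \<Rightarrow> (nat \<Rightarrow> real ^ 3) \<times> (nat \<Rightarrow> real ^ 3)" where
  "torus_map n z = (lift_conf n 0 z, lift_conf n 2 z)"

lemma norm_lift_conf: "i \<in> {1..n} \<Longrightarrow> norm (lift_conf n c z i) = real (i - 1)"
  by (simp add: lift_conf_def norm_sgn wrap_nonzero)

lemma lift_conf_in: "lift_conf n c z \<in> topspace (configuration_space n (euclidean :: (real ^ 3) topology))"
proof -
  have "lift_conf n c z i \<noteq> lift_conf n c z j" if "i \<in> {1..n}" "j \<in> {1..n}" "i \<noteq> j" for i j
  proof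
    assume "lift_conf n c z i = lift_conf n c z j"
    then have "real (i - 1) = real (j - 1)"
      using norm_lift_conf that by metis
    then show False using that by auto
  qed
  then show ?thesis unfolding topspace_configuration_space by (simp add: lift_conf_def)
qed

lemma continuous_map_lift_conf:
  "continuous_map euclidean (configuration_space n (euclidean :: (real ^ 3) topology)) (lift_conf n c)"
proof -
  have "continuous_on UNIV (\<lambda>z. lift_conf n c z i)" if "i \<in> {1..n}" for i
  proof -
    have "continuous_on UNIV (\<lambda>z :: nat \<Rightarrow> real. sgn (wrap (z a) (z b)))" for a b
      using continuous_on_wrap[OF continuous_on_product_coordinates continuous_on_product_coordinates]
      unfolding sgn_div_norm by (intro continuous_intros) (auto simp: wrap_nonzero)
    then show ?thesis
      using that by (cases "i = 1") (auto simp: lift_conf_def intro!: continuous_on_scaleR)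
  qed
  then show ?thesis
    by (simp add: continuous_map_into_configuration_space lift_conf_in)
qed

lemma continuous_map_torus_map:
  "continuous_map euclidean
     (prod_topology (configuration_space n euclidean) (configuration_space n euclidean)) (torus_map n)"
  unfolding torus_map_def [abs_def] by (simp add: continuous_map_paired continuous_map_lift_conf)

lemma lift_conf_diff:
  assumes "j + 2 \<le> n"
  shows "label (lift_conf n c z (j + 2) - lift_conf n c z 1) = label (wrap (z (4 * j + c)) (z (Suc (4 * j + c))))"
  using assms by (simp add: lift_conf_def sgn_div_norm label_scaleR wrap_nonzero)

lemma compact_unit_cube: "compact {z :: nat \<Rightarrow> real. \<forall>i. z i \<in> {0..1}}"
proof -
  have "{z :: nat \<Rightarrow> real. \<forall>i. z i \<in> {0..1}} = PiE UNIV (\<lambda>_. {0..1})" by auto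
  moreover have "compactin (product_topology (\<lambda>_. euclidean) UNIV) (PiE UNIV (\<lambda>_ :: nat. {0..1 :: real}))"
    by (simp add: compactin_PiE)
  ultimately show ?thesis by (simp add: euclidean_product_topology)
qed

text \<open>With fewer sets there are at most \<open>2 * m\<close> planners. Planner
  \<open>i\<close> is used to trivialize the zero divisor \<open>i div 2\<close> over its own set,
  which contradicts \<open>no_lattice_trivialization\<close> on a sufficiently fine lattice.\<close>

theorem configuration_space_cover_lower_bound:
  fixes U :: "nat \<Rightarrow> ((nat \<Rightarrow> real ^ 3) \<times> (nat \<Rightarrow> real ^ 3)) set"
  defines "M \<equiv> \<lambda>n. configuration_space n (euclidean :: (real ^ 3) topology)"
  assumes n: "n \<ge> 1"
    and U: "\<And>i. i < k \<Longrightarrow> openin (prod_topology (M n) (M n)) (U i)"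
    and planner: "\<And>i. i < k \<Longrightarrow> has_motion_planner (M n) (U i)"
    and cover: "(\<Union>i<k. U i) = topspace (prod_topology (M n) (M n))"
  shows "2 * n - 1 \<le> k"
proof (rule ccontr)
  define m where "m = n - 1"
  assume "\<not> 2 * n - 1 \<le> k"
  then have km: "k \<le> 2 * m" using n by (simp add: m_def)
  let ?MM = "prod_topology (M n) (M n)"
  let ?I = "{0..1::real}"
  define V where "V i = {z. torus_map n z \<in> U i}" for i
  have cont_torus: "continuous_map euclidean ?MM (torus_map n)"
    unfolding M_def by (rule continuous_map_torus_map)
  have V_open: "open (V i)" if "i < k" for i
    using cont_torus U[OF that] unfolding continuous_map_def V_def by auto
  have torus_in: "torus_map n z \<in> topspace ?MM" for z
    using cont_torus by (auto simp: continuous_map_def)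
  have V_cover: "z \<in> (\<Union>i<k. V i)" for z
    using torus_in[of z] unfolding cover[symmetric] by (simp add: V_def)
  have "\<forall>i. \<exists>h. i < k \<longrightarrow> continuous_map (prod_topology (top_of_set ?I) (subtopology ?MM (U i))) (M n) h \<and>
      (\<forall>z. h (0, z) = fst z) \<and> (\<forall>z. h (1, z) = snd z)"
    using planner openin_subset[OF U] has_motion_planner_iff_homotopic unfolding homotopic_with_def
    by metis
  then obtain h where h: "\<And>i. i < k \<Longrightarrow>
      continuous_map (prod_topology (top_of_set ?I) (subtopology ?MM (U i))) (M n) (h i)"
      "\<And>i z. i < k \<Longrightarrow> h i (0, z) = fst z" "\<And>i z. i < k \<Longrightarrow> h i (1, z) = snd z"
    by metis
  \<comment> \<open>The vector from particle 1 to particle \<open>i div 2 + 2\<close> along the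
    planned motion: a nowhere zero homotopy between the two directions compared by zero divisor
    \<open>i div 2\<close>.\<close>
  define f where "f i p = h i (fst p, torus_map n (snd p)) (i div 2 + 2) - h i (fst p, torus_map n (snd p)) 1"
    for i and p :: "real \<times> (nat \<Rightarrow> real)"
  have idiv: "i div 2 + 2 \<in> {1..n}" "1 \<in> {1..n}" "i div 2 < m" if "i < k" for i
    using that km n by (auto simp: m_def)
  have H: "continuous_map (top_of_set (?I \<times> V i)) (M n) (\<lambda>p. h i (fst p, torus_map n (snd p)))"
    if "i < k" for i
  proof -
    have "continuous_map (top_of_set (?I \<times> V i)) (prod_topology (top_of_set ?I) (subtopology ?MM (U i)))
        (\<lambda>p. (fst p, torus_map n (snd p)))"
      unfolding continuous_map_paired
    proof
      show "continuous_map (top_of_set (?I \<times> V i)) (top_of_set ?I) fst"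
        by (auto intro!: continuous_intros)
      have "continuous_map (top_of_set (?I \<times> V i)) ?MM (torus_map n \<circ> snd)"
        unfolding continuous_map_iff_continuous
        by (intro continuous_map_compose[OF _ cont_torus])
          (simp only: continuous_map_iff_continuous continuous_on_snd continuous_on_id)
      then show "continuous_map (top_of_set (?I \<times> V i)) (subtopology ?MM (U i)) (\<lambda>p. torus_map n (snd p))"
        by (auto simp: continuous_map_in_subtopology V_def comp_def)
    qed
    from continuous_map_compose[OF this h(1)[OF that]] show ?thesis by (simp add: comp_def)
  qed
  have f_cont: "continuous_on (?I \<times> V i) (f i)" if "i < k" for i
  proof -
    have "continuous_on (?I \<times> V i) (\<lambda>p. h i (fst p, torus_map n (snd p)) j)" if "j \<in> {1..n}" for j
      using H[OF \<open>i < k\<close>] that by (simp add: M_def continuous_map_into_configuration_space)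
    then show ?thesis unfolding f_def using idiv[OF that] by (intro continuous_on_diff) auto
  qed
  have f_nonzero: "f i p \<noteq> 0" if "i < k" "p \<in> ?I \<times> V i" for i p
  proof -
    have "h i (fst p, torus_map n (snd p)) \<in> topspace (M n)"
      using H[OF that(1)] that(2) by (auto simp: continuous_map_def)
    then show ?thesis
      using idiv[OF that(1)] by (auto simp: M_def topspace_configuration_space f_def)
  qed
  define Q where "Q = {z :: nat \<Rightarrow> real. \<forall>i. z i \<in> {0..1}}"
  have Q: "compact Q" unfolding Q_def by (rule compact_unit_cube)
  \<comment> \<open>A Lebesgue number for the open cover of the compact cube
    \<open>Q\<close>.\<close>
  obtain \<epsilon> where \<epsilon>: "\<epsilon> > 0" "\<And>z. z \<in> Q \<Longrightarrow> \<exists>G\<in>V ` {..<k}. ball z \<epsilon> \<subseteq> G"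
    using Heine_Borel_lemma[OF Q, of "V ` {..<k}"] V_cover V_open by blast
  \<comment> \<open>A compact part of \<open>V i\<close> on which uniform estimates hold. It
    contains every point of \<open>Q\<close> within \<open>\<epsilon> / 2\<close> of a point whose
    \<open>\<epsilon>\<close>-ball lies in \<open>V i\<close>.\<close>
  define K where "K i = Q \<inter> (\<Inter>y\<in>- V i. {z. \<epsilon> / 2 \<le> dist z y})" for i
  have K_compact: "compact (K i)" for i
    unfolding K_def
    by (intro compact_Int_closed Q closed_INT ballI closed_Collect_le continuous_intros)
  have K_V: "K i \<subseteq> V i" for i
  proof
    fix z assume z: "z \<in> K i"
    show "z \<in> V i"
    proof (rule ccontr)
      assume "z \<notin> V i"
      then have "\<epsilon> / 2 \<le> dist z z" using z unfolding K_def by blast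
      then show False using \<epsilon>(1) by simp
    qed
  qed
  have ev1: "\<forall>\<^sub>F \<delta> in at_right 0. \<forall>X\<subseteq>?I \<times> K i. (\<forall>x\<in>X. \<forall>y\<in>X. dist x y < \<delta>) \<longrightarrow>
      \<not> {0, 1, 2, 3} \<subseteq> label ` f i ` X" if "i < k" for i
  proof (rule eventually_label_not_surj)
    show "compact (?I \<times> K i)" using K_compact by (intro compact_Times) auto
    show "continuous_on (?I \<times> K i) (f i)"
      using f_cont[OF that] by (rule continuous_on_subset) (use K_V in auto)
    have "f i p \<noteq> 0" if "p \<in> ?I \<times> K i" for p
      by (rule f_nonzero[OF \<open>i < k\<close>]) (use that K_V in auto)
    then show "0 \<notin> f i ` (?I \<times> K i)" by (metis imageE)
  qed
  have ev2: "\<forall>\<^sub>F \<delta> in at_right 0. \<forall>X\<subseteq>?I \<times> ?I. (\<forall>x\<in>X. \<forall>y\<in>X. dist x y < \<delta>) \<longrightarrow>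
      \<not> {0, 1, 2, 3} \<subseteq> label ` (\<lambda>p. wrap (fst p) (snd p)) ` X"
  proof (rule eventually_label_not_surj)
    show "compact (?I \<times> ?I)" by (intro compact_Times compact_Icc)
    show "continuous_on (?I \<times> ?I) (\<lambda>p. wrap (fst p) (snd p))"
      by (intro continuous_on_wrap continuous_on_fst continuous_on_snd continuous_on_id)
    show "0 \<notin> (\<lambda>p. wrap (fst p) (snd p)) ` (?I \<times> ?I)"
    proof
      assume "0 \<in> (\<lambda>p. wrap (fst p) (snd p)) ` (?I \<times> ?I)"
      then obtain p where "0 = wrap (fst p) (snd p)" by blast
      then show False using wrap_nonzero[of "fst p" "snd p"] by simp
    qed
  qed
  have evK: "\<forall>\<^sub>F \<delta> in at_right 0. \<forall>i\<in>{..<k}. \<forall>X\<subseteq>?I \<times> K i. (\<forall>x\<in>X. \<forall>y\<in>X. dist x y < \<delta>) \<longrightarrow>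
      \<not> {0, 1, 2, 3} \<subseteq> label ` f i ` X"
    by (intro eventually_ball_finite ballI ev1) auto
  have "\<forall>\<^sub>F \<delta> in at_right 0. 0 < \<delta> \<and>
      (\<forall>i\<in>{..<k}. \<forall>X\<subseteq>?I \<times> K i. (\<forall>x\<in>X. \<forall>y\<in>X. dist x y < \<delta>) \<longrightarrow> \<not> {0, 1, 2, 3} \<subseteq> label ` f i ` X) \<and>
      (\<forall>X\<subseteq>?I \<times> ?I. (\<forall>x\<in>X. \<forall>y\<in>X. dist x y < \<delta>) \<longrightarrow>
        \<not> {0, 1, 2, 3} \<subseteq> label ` (\<lambda>p. wrap (fst p) (snd p)) ` X)"
    by (intro eventually_conj evK ev2 eventually_at_right_less)
  from eventually_happens'[OF trivial_limit_at_right_real this]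
  obtain \<delta> where \<delta>_pos: "0 < \<delta>" and
    \<delta>1: "\<forall>i\<in>{..<k}. \<forall>X\<subseteq>?I \<times> K i. (\<forall>x\<in>X. \<forall>y\<in>X. dist x y < \<delta>) \<longrightarrow> \<not> {0, 1, 2, 3} \<subseteq> label ` f i ` X" and
    \<delta>2: "\<forall>X\<subseteq>?I \<times> ?I. (\<forall>x\<in>X. \<forall>y\<in>X. dist x y < \<delta>) \<longrightarrow>
        \<not> {0, 1, 2, 3} \<subseteq> label ` (\<lambda>p. wrap (fst p) (snd p)) ` X"
    by (elim exE conjE)
  have \<delta>_f: "\<not> {0, 1, 2, 3} \<subseteq> label ` f i ` X"
    if "i < k" "X \<subseteq> ?I \<times> K i" "\<And>x y. x \<in> X \<Longrightarrow> y \<in> X \<Longrightarrow> dist x y < \<delta>" for i X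
    using \<delta>1 that by (meson lessThan_iff)
  have \<delta>_wrap: "\<not> {0, 1, 2, 3} \<subseteq> label ` (\<lambda>p. wrap (fst p) (snd p)) ` X"
    if "X \<subseteq> ?I \<times> ?I" "\<And>x y. x \<in> X \<Longrightarrow> y \<in> X \<Longrightarrow> dist x y < \<delta>" for X
    using \<delta>2 that by meson
  \<comment> \<open>With \<open>N = 2 * L\<close> a cube has diameter at most \<open>2 / N\<close>,
    and \<open>3 / N\<close> after a time step is added. The first bound keeps prisms below
    \<open>\<delta>\<close>, the second keeps cubes inside \<open>K i\<close>;
    \<open>L \<ge> 2\<close> serves the degree computation.\<close>
  obtain L :: nat where L: "L \<ge> 2" "3 / real (2 * L) < \<delta>" "2 / real (2 * L) < \<epsilon> / 2"
  proof -
    obtain L1 :: nat where L1: "real L1 > 3 / \<delta>" using reals_Archimedean2 by blast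
    obtain L2 :: nat where L2: "real L2 > 4 / \<epsilon>" using reals_Archimedean2 by blast
    define L where "L = L1 + L2 + 2"
    have "3 / \<delta> < real (2 * L)" "4 / \<epsilon> < real (2 * L)"
      using L1 L2 by (auto simp: L_def)
    then have "3 / real (2 * L) < \<delta>" "2 / real (2 * L) < \<epsilon> / 2"
      using \<delta>_pos \<epsilon>(1) by (auto simp: field_simps L_def)
    then show ?thesis using that[of L] by (simp add: L_def)
  qed
  define N where "N = 2 * L"
  have N: "N > 0" using L by (simp add: N_def)
  define lab where "lab i j = label (wrap (real i / real N) (real j / real N))" for i j
  define grid where "grid v = (\<lambda>c. if c < 4 * m then real (v c) / real N else 0)" for v :: "nat \<Rightarrow> nat"
  define F where "F i \<tau> v = label (f i (real \<tau> / real N, grid v))" for i \<tau> v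
  \<comment> \<open>The primitive: prisms along the planned motion, with time cut into
    \<open>N\<close> steps as well.\<close>
  define \<eta> where "\<eta> i vs = (\<Sum>\<tau><N. prism (F i \<tau>) (F i (Suc \<tau>)) orientation vs)" for i vs
  have cell_le: "v c \<le> N" if "in_cell (4 * m) w vs" "v \<in> set vs" "c < 4 * m" "\<forall>c<4 * m. w c < N" for v vs w c
    using that unfolding in_cell_def by (metis Suc_leI less_imp_le)
  have cell_Q: "grid v \<in> Q" if "in_cell (4 * m) w vs" "v \<in> set vs" "\<forall>c<4 * m. w c < N" for v vs w
    using cell_le[OF that(1,2) _ that(3)] N by (auto simp: Q_def grid_def)
  have near: "dist (real a / real N) (real b / real N) \<le> 1 / real N" if "a \<le> Suc b" "b \<le> Suc a" for a b
    using that N by (auto simp: dist_real_def field_simps abs_le_iff)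
  have cell_near: "v c \<le> Suc (u c)" if "in_cell (4 * m) w vs" "u \<in> set vs" "v \<in> set vs" "c < 4 * m" for u v w vs c
    using that unfolding in_cell_def by (metis le_SucI order_refl le_Suc_eq)
  have cell_dist: "dist (grid u) (grid v) \<le> 2 / real N"
    if "in_cell (4 * m) w vs" "u \<in> set vs" "v \<in> set vs" for u v w vs
  proof -
    have "dist (grid u i) (grid v i) \<le> 1 / real N" for i
      using near[OF cell_near[OF that(1,3,2)] cell_near[OF that]] by (auto simp: grid_def)
    from dist_fun_le[of "grid u", OF this] show ?thesis by simp
  qed
  show False
  proof (rule no_lattice_trivialization[where m = m])
    show "normalized orientation" by (rule normalized_orientation)
    show "lattice_degree N lab orientation \<noteq> 0"
      using lattice_degree_wrap[OF L(1)] by (simp add: N_def lab_def [abs_def])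
    show "lab N t = lab 0 t" "lab s N = lab s 0" for s t
      using N by (auto simp: lab_def)
    show "N > 0" by (rule N)
  next
    fix j vs w assume j: "j < m" and vs: "length vs = 4" "\<forall>c<4 * m. w c < N" "in_cell (4 * m) w vs"
    have "coboundary (pullback_cochain lab orientation c) vs = 0" if "Suc c < 4 * m" for c
    proof -
      let ?X = "(\<lambda>v. (real (v c) / real N, real (v (Suc c)) / real N)) ` set vs"
      have "\<not> {0, 1, 2, 3} \<subseteq> label ` (\<lambda>p. wrap (fst p) (snd p)) ` ?X"
      proof (rule \<delta>_wrap)
        show "?X \<subseteq> ?I \<times> ?I"
          using cell_le[OF vs(3) _ _ vs(2)] that N by auto
        fix x y assume "x \<in> ?X" "y \<in> ?X"
        then obtain u v where u: "u \<in> set vs" "v \<in> set vs"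
          and x: "x = (real (u c) / real N, real (u (Suc c)) / real N)"
          and y: "y = (real (v c) / real N, real (v (Suc c)) / real N)" by auto
        have "dist x y \<le> 1 / real N + 1 / real N"
          unfolding x y using that u cell_near[OF vs(3)]
          by (intro order_trans[OF dist_Pair_le] add_mono near) auto
        also have "\<dots> < \<delta>" using L(2) N by (simp add: N_def field_simps)
        finally show "dist x y < \<delta>" .
      qed
      then have "\<not> {0, 1, 2, 3} \<subseteq> set (map (\<lambda>v. lab (v c) (v (Suc c))) vs)"
        by (simp add: image_image lab_def)
      moreover have "set (map (\<lambda>v. lab (v c) (v (Suc c))) vs) \<subseteq> {0, 1, 2, 3}"
        unfolding lab_def set_map by (rule image_subsetI, rule label_in)
      ultimately have "coboundary orientation (map (\<lambda>v. lab (v c) (v (Suc c))) vs) = 0"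
        using vs(1) by (intro coboundary_orientation) (simp only: length_map)
      then show ?thesis unfolding pullback_cochain_def [abs_def] coboundary_map .
    qed
    then show "coboundary (zero_divisor lab orientation j) vs = 0"
      using j unfolding zero_divisor_def [abs_def] coboundary_diff by simp
  next
    fix i assume "i < 2 * m"
    have "torus_map n (grid (v(c := N))) = torus_map n (grid (v(c := 0)))" if "c < 4 * m" for v c
    proof -
      have "wrap (grid (v(c := N)) a) (grid (v(c := N)) b) = wrap (grid (v(c := 0)) a) (grid (v(c := 0)) b)" for a b
        using N that by (auto simp: grid_def)
      then show ?thesis unfolding torus_map_def lift_conf_def by (simp only:)
    qed
    then have "F i \<tau> (v(c := N)) = F i \<tau> (v(c := 0))" if "c < 4 * m" for \<tau> v c
      using that by (simp add: F_def f_def)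
    then show "periodic N (4 * m) (\<eta> i)"
      by (simp add: periodic_def \<eta>_def prism_map comp_def)
  next
    fix w :: "nat \<Rightarrow> nat" assume w: "\<forall>c<4 * m. w c < N"
    have "in_cell (4 * m) w [w]" by (simp add: in_cell_def)
    then have "grid w \<in> Q" using cell_Q[of w "[w]" w] w by simp
    then obtain i where i: "i < k" "ball (grid w) \<epsilon> \<subseteq> V i" using \<epsilon>(2) by blast
    have "zero_divisor lab orientation (i div 2) vs + coboundary (\<eta> i) vs = 0"
      if vs: "length vs = 3" "in_cell (4 * m) w vs" for vs
    proof -
      \<comment> \<open>The corner \<open>w\<close>, whose ball lies in \<open>V i\<close>, is added
        to the simplex in order to bound distances from it.\<close>
      have wvs: "in_cell (4 * m) w (w # vs)" using vs(2) by (simp add: in_cell_def)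
      have in_K: "grid v \<in> K i" if "v \<in> set vs" for v
      proof -
        have "\<epsilon> / 2 \<le> dist (grid v) y" if "y \<notin> V i" for y
        proof -
          have "\<epsilon> \<le> dist (grid w) y" using i(2) that by (meson mem_ball not_le subsetD)
          also have "\<dots> \<le> dist (grid w) (grid v) + dist (grid v) y" by (rule dist_triangle)
          also have "dist (grid w) (grid v) \<le> 2 / real N"
            using cell_dist[OF wvs] \<open>v \<in> set vs\<close> by simp
          finally show ?thesis using L(3) by (simp add: N_def)
        qed
        then show ?thesis using cell_Q[OF vs(2) that w] by (auto simp: K_def)
      qed
      have prism0: "prism (F i \<tau>) (F i (Suc \<tau>)) (coboundary orientation) vs = 0" if "\<tau> < N" for \<tau>
      proof -
        let ?X = "{real \<tau> / real N, real (Suc \<tau>) / real N} \<times> grid ` set vs"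
        have X: "\<not> {0, 1, 2, 3} \<subseteq> label ` f i ` ?X"
        proof (rule \<delta>_f[OF i(1)])
          show "?X \<subseteq> ?I \<times> K i"
            using that in_K N by auto
          fix x y assume "x \<in> ?X" "y \<in> ?X"
          then obtain a u b v where u: "u \<in> set vs" "v \<in> set vs" "a \<in> {\<tau>, Suc \<tau>}" "b \<in> {\<tau>, Suc \<tau>}"
            and x: "x = (real a / real N, grid u)" and y: "y = (real b / real N, grid v)" by blast
          have "dist x y \<le> 1 / real N + 2 / real N"
            unfolding x y using u
            by (intro order_trans[OF dist_Pair_le] add_mono near cell_dist[OF vs(2)]) auto
          also have "\<dots> < \<delta>" using L(2) N by (simp add: N_def field_simps)
          finally show "dist x y < \<delta>" .
        qed
        have "prism (F i \<tau>) (F i (Suc \<tau>)) (coboundary orientation) vs = prism (F i \<tau>) (F i (Suc \<tau>)) (\<lambda>ws. 0 * orientation ws) vs"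
        proof (rule prism_cong)
          fix ws assume ws: "set ws \<subseteq> F i \<tau> ` set vs \<union> F i (Suc \<tau>) ` set vs" "length ws = Suc (length vs)"
          have "F i \<tau> ` set vs \<union> F i (Suc \<tau>) ` set vs \<subseteq> label ` f i ` ?X"
            by (auto simp: F_def)
          with ws(1) have wsX: "set ws \<subseteq> label ` f i ` ?X" by (rule order_trans)
          have "label ` f i ` ?X \<subseteq> {0, 1, 2, 3}"
            by (rule image_subsetI, rule label_in)
          with wsX have "set ws \<subseteq> {0, 1, 2, 3}" by (rule order_trans)
          moreover have "\<not> {0, 1, 2, 3} \<subseteq> set ws"
            using X order_trans[OF _ wsX] by metis
          ultimately have "coboundary orientation ws = 0"
            using ws(2) vs(1) by (intro coboundary_orientation) simp_all
          then show "coboundary orientation ws = 0 * orientation ws" by simp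
        qed
        then show ?thesis unfolding prism_cmult by simp
      qed
      \<comment> \<open>The labels of each prism miss one of the four values, so the prism of the
        coboundary vanishes and the homotopy identities telescope over time. At time 0 the labels
        are those of the first configuration, at time \<open>N\<close> those of the second, and the
        sum is minus the zero divisor.\<close>
      have "coboundary (\<eta> i) vs = (\<Sum>\<tau><N. coboundary (prism (F i \<tau>) (F i (Suc \<tau>)) orientation) vs)"
        by (simp add: \<eta>_def [abs_def] coboundary_sum)
      also have "\<dots> = (\<Sum>\<tau><N. orientation (map (F i (Suc \<tau>)) vs) - orientation (map (F i \<tau>) vs))"
      proof (rule sum.cong[OF refl])
        fix \<tau> assume "\<tau> \<in> {..<N}"
        then show "coboundary (prism (F i \<tau>) (F i (Suc \<tau>)) orientation) vs =
            orientation (map (F i (Suc \<tau>)) vs) - orientation (map (F i \<tau>) vs)"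
          using prism_homotopy[of "F i \<tau>" "F i (Suc \<tau>)" orientation vs] prism0[of \<tau>] by simp
      qed
      also have "\<dots> = orientation (map (F i N) vs) - orientation (map (F i 0) vs)"
        by (rule sum_lessThan_telescope)
      also have "F i 0 v = lab (v (4 * (i div 2))) (v (Suc (4 * (i div 2))))" for v
        using idiv[OF i(1)] h(2)[OF i(1)] lift_conf_diff[of "i div 2" n 0 "grid v"]
        by (simp add: F_def f_def torus_map_def lab_def grid_def)
      then have "map (F i 0) vs = map (\<lambda>v. lab (v (4 * (i div 2))) (v (Suc (4 * (i div 2))))) vs" by simp
      also have "F i N v = lab (v (4 * (i div 2) + 2)) (v (Suc (4 * (i div 2) + 2)))" for v
        using idiv[OF i(1)] h(3)[OF i(1)] N lift_conf_diff[of "i div 2" n 2 "grid v"]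
        by (simp add: F_def f_def torus_map_def lab_def grid_def)
      then have "map (F i N) vs = map (\<lambda>v. lab (v (4 * (i div 2) + 2)) (v (Suc (4 * (i div 2) + 2)))) vs" by simp
      finally show ?thesis by (simp add: zero_divisor_def pullback_cochain_def)
    qed
    then show "\<exists>i<2 * m. \<forall>vs. length vs = 3 \<longrightarrow> in_cell (4 * m) w vs \<longrightarrow>
        zero_divisor lab orientation (i div 2) vs + coboundary (\<eta> i) vs = 0"
      using i(1) km by (intro exI[of _ i]) auto
  qed
qed

subsection \<open>The upper bound\<close>

lemma same_sign_convex_nonzero:
  fixes a b t :: real
  assumes "a * b > 0" "0 \<le> t" "t \<le> 1"
  shows "(1 - t) * a + t * b \<noteq> 0"
proof -
  have pos: "(1 - t) * a + t * b > 0" if "a > 0" "b > 0" for a b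
    using that assms(2,3) by (cases "t = 1") (auto intro!: add_pos_nonneg mult_pos_pos)
  show ?thesis
    using pos[of a b] pos[of "- a" "- b"] assms(1) by (auto simp: zero_less_mult_iff)
qed

lemma continuous_map_scaleR:
  fixes g :: "'a \<Rightarrow> 'b::real_normed_vector"
  assumes "continuous_map X euclideanreal f" "continuous_map X euclidean g"
  shows "continuous_map X euclidean (\<lambda>x. f x *\<^sub>R g x)"
  using assms by (simp add: continuous_map_atin limitin_canonical_iff tendsto_scaleR)

text \<open>Along the straight-line homotopy two particles stay apart, because some coordinate of
  their difference keeps its sign.\<close>

lemma homotopic_configurations_linear:
  fixes f g :: "'a \<Rightarrow> nat \<Rightarrow> real ^ 3"
  assumes f: "\<And>i. i \<in> {1..n} \<Longrightarrow> continuous_map Z euclidean (\<lambda>z. f z i)"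
      "\<And>z. z \<in> topspace Z \<Longrightarrow> f z \<in> extensional {1..n}"
    and g: "\<And>i. i \<in> {1..n} \<Longrightarrow> continuous_map Z euclidean (\<lambda>z. g z i)"
      "\<And>z. z \<in> topspace Z \<Longrightarrow> g z \<in> extensional {1..n}"
    and sep: "\<And>z i j. z \<in> topspace Z \<Longrightarrow> i \<in> {1..n} \<Longrightarrow> j \<in> {1..n} \<Longrightarrow> i \<noteq> j \<Longrightarrow>
      \<exists>k. (f z i $ k - f z j $ k) * (g z i $ k - g z j $ k) > 0"
  shows "homotopic_with (\<lambda>_. True) Z (configuration_space n euclidean) f g"
proof -
  define h where "h = (\<lambda>p. \<lambda>i\<in>{1..n}. (1 - fst p) *\<^sub>R f (snd p) i + fst p *\<^sub>R g (snd p) i)"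
  let ?P = "prod_topology (top_of_set {0..1::real}) Z"
  have "continuous_map ?P (configuration_space n euclidean) h"
    unfolding continuous_map_into_configuration_space
  proof (intro conjI ballI)
    fix i assume i: "i \<in> {1..n}"
    have t: "continuous_map ?P euclideanreal fst"
      using continuous_map_fst continuous_map_into_fulltopology by blast
    have "continuous_map ?P euclidean (\<lambda>p. f (snd p) i)" "continuous_map ?P euclidean (\<lambda>p. g (snd p) i)"
      using continuous_map_compose[OF continuous_map_snd f(1)[OF i]]
        continuous_map_compose[OF continuous_map_snd g(1)[OF i]] by (simp_all add: comp_def)
    then have "continuous_map ?P euclidean (\<lambda>p. (1 - fst p) *\<^sub>R f (snd p) i + fst p *\<^sub>R g (snd p) i)"
      using t by (intro continuous_intros continuous_map_scaleR)
    then show "continuous_map ?P euclidean (\<lambda>p. h p i)" using i by (simp add: h_def)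
  next
    fix p assume p: "p \<in> topspace ?P"
    have "h p i \<noteq> h p j" if ij: "i \<in> {1..n}" "j \<in> {1..n}" "i \<noteq> j" for i j
    proof -
      obtain k where k: "(f (snd p) i $ k - f (snd p) j $ k) * (g (snd p) i $ k - g (snd p) j $ k) > 0"
        using sep[of "snd p" i j] p ij by auto
      have "(1 - fst p) * (f (snd p) i $ k - f (snd p) j $ k) + fst p * (g (snd p) i $ k - g (snd p) j $ k) \<noteq> 0"
        by (rule same_sign_convex_nonzero[OF k]) (use p in auto)
      then have "h p i $ k \<noteq> h p j $ k" using ij by (simp add: h_def algebra_simps)
      then show ?thesis by metis
    qed
    then show "h p \<in> topspace (configuration_space n euclidean)"
      unfolding topspace_configuration_space by (simp add: h_def)
  qed
  moreover have "h (0, z) = f z" "h (1, z) = g z" if "z \<in> topspace Z" for z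
    using f(2)[OF that] g(2)[OF that] by (auto simp: h_def fun_eq_iff extensional_def)
  ultimately show ?thesis
    unfolding homotopic_with[of Z "\<lambda>_. True" _ f g, OF refl] by (intro exI[of _ h]) simp
qed

lemma has_motion_planner_disjoint_Union:
  assumes "\<And>i. i \<in> I \<Longrightarrow> openin (prod_topology X X) (W i)"
    and "\<And>i. i \<in> I \<Longrightarrow> has_motion_planner X (W i)"
    and disj: "\<And>i j. i \<in> I \<Longrightarrow> j \<in> I \<Longrightarrow> W i \<inter> W j \<noteq> {} \<Longrightarrow> i = j"
  shows "has_motion_planner X (\<Union>i\<in>I. W i)"
proof -
  let ?XX = "prod_topology X X" and ?O = "\<Union>i\<in>I. W i"
  obtain s where s: "\<And>i. i \<in> I \<Longrightarrow> continuous_map (subtopology ?XX (W i)) (path_space X) (s i)"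
      "\<And>i z. i \<in> I \<Longrightarrow> z \<in> W i \<Longrightarrow> path_ends (s i z) = z"
    using assms(2) unfolding has_motion_planner_def by metis
  obtain g where g: "continuous_map (subtopology ?XX ?O) (path_space X) g"
      "\<And>z i. i \<in> I \<Longrightarrow> z \<in> topspace (subtopology ?XX ?O) \<inter> W i \<Longrightarrow> g z = s i z"
  proof (rule pasting_lemma_exists[where X = "subtopology ?XX ?O" and I = I and T = W and f = s and Y = "path_space X"])
    show "topspace (subtopology ?XX ?O) \<subseteq> ?O" by auto
    show "openin (subtopology ?XX ?O) (W i)" if "i \<in> I" for i
      using assms(1)[OF that] that by (auto simp: openin_subtopology)
    show "continuous_map (subtopology (subtopology ?XX ?O) (W i)) (path_space X) (s i)" if "i \<in> I" for i
    proof -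
      have "?O \<inter> W i = W i" using that by auto
      then show ?thesis using s(1)[OF that] by (simp add: subtopology_subtopology)
    qed
    show "s i z = s j z" if "i \<in> I" "j \<in> I" "z \<in> topspace (subtopology ?XX ?O) \<inter> W i \<inter> W j" for i j z
      using disj[of i j] that by auto
  qed blast
  have "path_ends (g z) = z" if z: "z \<in> ?O" for z
  proof -
    obtain i where "i \<in> I" "z \<in> W i" using z by blast
    moreover have "z \<in> topspace ?XX" using assms(1) calculation openin_subset by blast
    ultimately have "g z = s i z" using z by (intro g(2)) auto
    then show ?thesis using s(2) \<open>i \<in> I\<close> \<open>z \<in> W i\<close> by metis
  qed
  with g(1) show ?thesis unfolding has_motion_planner_def by blast
qed

section \<open>Stratification of pairs of configurations by height\<close>

type_synonym conf_pair = "(nat \<Rightarrow> real ^ 3) \<times> (nat \<Rightarrow> real ^ 3)"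

definition side :: "bool \<Rightarrow> conf_pair \<Rightarrow> nat \<Rightarrow> real ^ 3" where
  "side b z = (if b then snd z else fst z)"

definition height :: "conf_pair \<Rightarrow> bool \<times> nat \<Rightarrow> real" where
  "height z p = side (fst p) z (snd p) $ 1"

definition particles :: "nat \<Rightarrow> (bool \<times> nat) set" where
  "particles n = UNIV \<times> {1..n}"

text \<open>Only particles of the same configuration are compared, and equal heights get equal
  ranks. The restriction to \<open>particles n\<close> makes the function determined by its relevant
  values.\<close>

definition height_rank :: "nat \<Rightarrow> conf_pair \<Rightarrow> bool \<times> nat \<Rightarrow> nat" where
  "height_rank n z = (\<lambda>p\<in>particles n. card {q \<in> particles n. fst q = fst p \<and> height z q < height z p})"

text \<open>Names the block of a particle. The tag keeps the two configurations in separate blocks,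
  even where heights coincide.\<close>

definition level :: "(bool \<times> nat \<Rightarrow> nat) \<Rightarrow> bool \<times> nat \<Rightarrow> bool \<times> nat" where
  "level \<rho> p = (fst p, \<rho> p)"

text \<open>The first two conditions, order of the blocks and separation within a block, make the
  straightening possible. The third compares gaps within blocks to gaps between blocks, also across
  the two configurations, and separates different strata. All three are open.\<close>

definition stratum_nbhd :: "nat \<Rightarrow> (bool \<times> nat \<Rightarrow> nat) \<Rightarrow> conf_pair set" where
  "stratum_nbhd n \<rho> =
    {z \<in> topspace (prod_topology (configuration_space n euclidean) (configuration_space n euclidean)).
      \<forall>p\<in>particles n. \<forall>q\<in>particles n.
        (fst p = fst q \<and> \<rho> p < \<rho> q \<longrightarrow> height z p < height z q) \<and>
        (p \<noteq> q \<and> level \<rho> p = level \<rho> q \<longrightarrow>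
          side (fst p) z (snd p) $ 2 \<noteq> side (fst p) z (snd q) $ 2 \<or>
          side (fst p) z (snd p) $ 3 \<noteq> side (fst p) z (snd q) $ 3) \<and>
        (\<forall>r\<in>particles n. \<forall>s\<in>particles n.
          level \<rho> p = level \<rho> q \<and> fst r = fst s \<and> \<rho> r \<noteq> \<rho> s \<longrightarrow>
          \<bar>height z p - height z q\<bar> < \<bar>height z r - height z s\<bar>)}"

lemma finite_particles [simp]: "finite (particles n)"
  by (simp add: particles_def)

lemma card_particles: "card (particles n) = 2 * n"
  by (simp add: particles_def card_cartesian_product)

lemma height_rank_less_iff:
  assumes "p \<in> particles n" "q \<in> particles n" "fst p = fst q"
  shows "height_rank n z p < height_rank n z q \<longleftrightarrow> height z p < height z q"
proof -
  let ?S = "\<lambda>p. {q \<in> particles n. fst q = fst p \<and> height z q < height z p}"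
  have less: "card (?S p) < card (?S q)" if "p \<in> particles n" "fst p = fst q" "height z p < height z q" for p q
    by (rule psubset_card_mono) (use that in \<open>auto intro: less_trans\<close>)
  have le: "card (?S q) \<le> card (?S p)" if "height z q \<le> height z p" "fst p = fst q"
    by (rule card_mono) (use that in auto)
  show ?thesis using less[of p q] le assms by (force simp: height_rank_def)
qed

lemma height_rank_eq_iff:
  assumes "p \<in> particles n" "q \<in> particles n" "fst p = fst q"
  shows "height_rank n z p = height_rank n z q \<longleftrightarrow> height z p = height z q"
  using height_rank_less_iff[OF assms, of z] height_rank_less_iff[OF assms(2,1) assms(3)[symmetric], of z] by linarith

text \<open>For its own ranks all gaps within blocks are 0, and distinct particles of equal height
  differ in another coordinate.\<close>

lemma in_stratum_nbhd_height_rank: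
  assumes z: "z \<in> topspace (prod_topology (configuration_space n euclidean) (configuration_space n euclidean))"
  shows "z \<in> stratum_nbhd n (height_rank n z)"
  unfolding stratum_nbhd_def
proof (intro CollectI conjI ballI impI z)
  fix p q assume pq: "p \<in> particles n" "q \<in> particles n"
  show "height z p < height z q" if "fst p = fst q \<and> height_rank n z p < height_rank n z q"
    using that height_rank_less_iff[OF pq] by blast
  show "side (fst p) z (snd p) $ 2 \<noteq> side (fst p) z (snd q) $ 2 \<or>
          side (fst p) z (snd p) $ 3 \<noteq> side (fst p) z (snd q) $ 3"
    if "p \<noteq> q \<and> level (height_rank n z) p = level (height_rank n z) q"
  proof -
    have f: "fst p = fst q" "height_rank n z p = height_rank n z q" using that by (auto simp: level_def)
    then have "height z p = height z q" using height_rank_eq_iff[OF pq f(1)] by simp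
    then have 1: "side (fst p) z (snd p) $ 1 = side (fst p) z (snd q) $ 1" using f by (simp add: height_def)
    have "side (fst p) z \<in> topspace (configuration_space n euclidean)"
      using z by (auto simp: side_def)
    moreover have "snd p \<noteq> snd q" using that f by (auto simp: prod_eq_iff)
    ultimately have "side (fst p) z (snd p) \<noteq> side (fst p) z (snd q)"
      using pq by (auto simp: topspace_configuration_space particles_def)
    then show ?thesis using 1 by (auto simp: vec_eq_iff forall_3)
  qed
  fix r s assume rs: "r \<in> particles n" "s \<in> particles n"
  assume a: "level (height_rank n z) p = level (height_rank n z) q \<and> fst r = fst s \<and> height_rank n z r \<noteq> height_rank n z s"
  then have "height z p = height z q" using height_rank_eq_iff[OF pq] by (auto simp: level_def)
  moreover have "height z r \<noteq> height z s" using a height_rank_eq_iff[OF rs] by auto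
  ultimately show "\<bar>height z p - height z q\<bar> < \<bar>height z r - height z s\<bar>" by simp
qed

lemma stratum_nbhd_less:
  assumes "z \<in> stratum_nbhd n \<rho>" "p \<in> particles n" "q \<in> particles n" "fst p = fst q" "\<rho> p < \<rho> q"
  shows "height z p < height z q"
proof -
  note * = assms(1)[unfolded stratum_nbhd_def mem_Collect_eq, THEN conjunct2,
      THEN bspec, OF assms(2), THEN bspec, OF assms(3)]
  show ?thesis using *[THEN conjunct1] assms(4,5) by (simp only: simp_thms)
qed

lemma stratum_nbhd_separated:
  assumes "z \<in> stratum_nbhd n \<rho>" "p \<in> particles n" "q \<in> particles n" "p \<noteq> q" "level \<rho> p = level \<rho> q"
  shows "side (fst p) z (snd p) $ 2 \<noteq> side (fst p) z (snd q) $ 2 \<or>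
    side (fst p) z (snd p) $ 3 \<noteq> side (fst p) z (snd q) $ 3"
proof -
  note * = assms(1)[unfolded stratum_nbhd_def mem_Collect_eq, THEN conjunct2,
      THEN bspec, OF assms(2), THEN bspec, OF assms(3)]
  show ?thesis using *[THEN conjunct2, THEN conjunct1] assms(4,5) by (simp only: simp_thms not_False_eq_True)
qed

lemma stratum_nbhd_gap:
  assumes "z \<in> stratum_nbhd n \<rho>" "p \<in> particles n" "q \<in> particles n" "r \<in> particles n" "s \<in> particles n"
    "level \<rho> p = level \<rho> q" "fst r = fst s" "level \<rho> r \<noteq> level \<rho> s"
  shows "\<bar>height z p - height z q\<bar> < \<bar>height z r - height z s\<bar>"
proof -
  note * = assms(1)[unfolded stratum_nbhd_def mem_Collect_eq, THEN conjunct2,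
      THEN bspec, OF assms(2), THEN bspec, OF assms(3), THEN conjunct2, THEN conjunct2,
      THEN bspec, OF assms(4), THEN bspec, OF assms(5)]
  have "\<rho> r \<noteq> \<rho> s" using assms(7,8) by (simp add: level_def)
  with assms(6,7) show ?thesis by (intro *[THEN mp] conjI)
qed

text \<open>A refinement induces a surjection between the sets of blocks, which is injective since
  both are finite of the same size.\<close>

lemma partition_eqI:
  assumes "finite I" "card (f ` I) = card (g ` I)"
    and ref: "\<And>p q. p \<in> I \<Longrightarrow> q \<in> I \<Longrightarrow> f p = f q \<Longrightarrow> g p = g q"
    and "p \<in> I" "q \<in> I" "g p = g q"
  shows "f p = f q"
proof -
  obtain h where h: "\<And>p. p \<in> I \<Longrightarrow> h (f p) = g p"
  proof
    show "g (SOME q. q \<in> I \<and> f q = f p) = g p" if "p \<in> I" for p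
      using ref someI[of "\<lambda>q. q \<in> I \<and> f q = f p" p] that by blast
  qed
  then have "h ` f ` I = g ` I" by (auto simp: image_iff) 
  then have "inj_on h (f ` I)"
    using assms(1,2) by (intro eq_card_imp_inj_on) auto
  then show ?thesis using h assms(4-6) by (metis imageI inj_onD)
qed

text \<open>If neither partition refined the other, a pair of particles close for the first and far for the
  second one, and a pair of the opposite kind, would contradict the two gap conditions.\<close>

lemma stratum_nbhd_disjoint:
  assumes z: "z \<in> stratum_nbhd n (height_rank n x)" "z \<in> stratum_nbhd n (height_rank n y)"
    and card: "card (level (height_rank n x) ` particles n) = card (level (height_rank n y) ` particles n)"
  shows "height_rank n x = height_rank n y"
proof -
  let ?I = "particles n" and ?f = "level (height_rank n x)" and ?g = "level (height_rank n y)"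
  have fst: "fst p = fst q" if "level \<rho> p = level \<rho> q" for \<rho> p q
    using that by (simp add: level_def)
  have "(\<forall>p\<in>?I. \<forall>q\<in>?I. ?f p = ?f q \<longrightarrow> ?g p = ?g q) \<or> (\<forall>p\<in>?I. \<forall>q\<in>?I. ?g p = ?g q \<longrightarrow> ?f p = ?f q)"
  proof (rule ccontr)
    assume "\<not> ?thesis"
    then obtain p q r s where I: "p \<in> ?I" "q \<in> ?I" "r \<in> ?I" "s \<in> ?I"
      and *: "?f p = ?f q" "?g p \<noteq> ?g q" "?g r = ?g s" "?f r \<noteq> ?f s"
      unfolding Ball_def de_Morgan_disj not_all not_imp by (elim conjE exE)
    from stratum_nbhd_gap[OF z(1) I *(1) fst[OF *(3)] *(4)] stratum_nbhd_gap[OF z(2) I(3,4,1,2) *(3) fst[OF *(1)] *(2)]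
    show False by simp
  qed
  then have same: "?f p = ?f q \<longleftrightarrow> ?g p = ?g q" if pq: "p \<in> ?I" "q \<in> ?I" for p q
  proof
    assume ref: "\<forall>p\<in>?I. \<forall>q\<in>?I. ?f p = ?f q \<longrightarrow> ?g p = ?g q"
    show ?thesis
      using ref[rule_format, OF pq] partition_eqI[OF finite_particles card ref[rule_format] pq] by (rule iffI)
  next
    assume ref: "\<forall>p\<in>?I. \<forall>q\<in>?I. ?g p = ?g q \<longrightarrow> ?f p = ?f q"
    show ?thesis
      using partition_eqI[OF finite_particles card[symmetric] ref[rule_format] pq] ref[rule_format, OF pq] by (rule iffI)
  qed
  \<comment> \<open>The heights at the common point \<open>z\<close> decide the order of two blocks
    for both rank functions.\<close>
  have imp: "\<rho>' p < \<rho>' q"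
    if "z \<in> stratum_nbhd n \<rho>" "z \<in> stratum_nbhd n \<rho>'" "p \<in> ?I" "q \<in> ?I" "fst p = fst q" "\<rho> p < \<rho> q"
      "level \<rho> p = level \<rho> q \<longleftrightarrow> level \<rho>' p = level \<rho>' q" for \<rho> \<rho>' p q
  proof (rule ccontr)
    assume "\<not> \<rho>' p < \<rho>' q"
    moreover have "\<rho>' p \<noteq> \<rho>' q" using that(5-7) by (auto simp: level_def)
    ultimately have "height z q < height z p" using stratum_nbhd_less[OF that(2,4,3)] that(5) by simp
    then show False using stratum_nbhd_less[OF that(1,3,4,5,6)] by simp
  qed
  have order: "height_rank n x q < height_rank n x p \<longleftrightarrow> height_rank n y q < height_rank n y p"
    if "p \<in> ?I" "q \<in> ?I" "fst q = fst p" for p q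
  proof
    show "height_rank n y q < height_rank n y p" if "height_rank n x q < height_rank n x p"
      by (rule imp[OF z \<open>q \<in> ?I\<close> \<open>p \<in> ?I\<close> \<open>fst q = fst p\<close> that same[OF \<open>q \<in> ?I\<close> \<open>p \<in> ?I\<close>]])
    show "height_rank n x q < height_rank n x p" if "height_rank n y q < height_rank n y p"
      by (rule imp[OF z(2,1) \<open>q \<in> ?I\<close> \<open>p \<in> ?I\<close> \<open>fst q = fst p\<close> that same[OF \<open>q \<in> ?I\<close> \<open>p \<in> ?I\<close>, symmetric]])
  qed
  show ?thesis
  proof
    fix p
    show "height_rank n x p = height_rank n y p"
    proof (cases "p \<in> ?I")
      case True
      have "height x q < height x p \<longleftrightarrow> height y q < height y p" if "q \<in> ?I" "fst q = fst p" for q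
        using order[OF True that] by (simp only: height_rank_less_iff[OF that(1) True that(2)])
      then have "{q \<in> ?I. fst q = fst p \<and> height x q < height x p} = {q \<in> ?I. fst q = fst p \<and> height y q < height y p}"
        by blast
      then show ?thesis using True by (simp add: height_rank_def)
    qed (simp add: height_rank_def)
  qed
qed


section \<open>Open conditions and continuity of coordinates\<close>

lemma openin_Collect_ball:
  assumes "finite I" "\<And>i. i \<in> I \<Longrightarrow> openin X {x \<in> topspace X. P i x}"
  shows "openin X {x \<in> topspace X. \<forall>i\<in>I. P i x}"
proof -
  have "{x \<in> topspace X. \<forall>i\<in>I. P i x} = topspace X \<inter> (\<Inter>i\<in>I. {x \<in> topspace X. P i x})" by auto
  then show ?thesis using openin_INT[of I X "\<lambda>i. {x \<in> topspace X. P i x}"] assms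
    by (simp add: Int_commute)
qed

lemma openin_Collect_conj:
  assumes "openin X {x \<in> topspace X. P x}" "openin X {x \<in> topspace X. Q x}"
  shows "openin X {x \<in> topspace X. P x \<and> Q x}"
proof -
  have "{x \<in> topspace X. P x \<and> Q x} = {x \<in> topspace X. P x} \<inter> {x \<in> topspace X. Q x}" by auto
  then show ?thesis using assms by auto
qed

lemma openin_Collect_disj:
  assumes "openin X {x \<in> topspace X. P x}" "openin X {x \<in> topspace X. Q x}"
  shows "openin X {x \<in> topspace X. P x \<or> Q x}"
proof -
  have "{x \<in> topspace X. P x \<or> Q x} = {x \<in> topspace X. P x} \<union> {x \<in> topspace X. Q x}" by auto
  then show ?thesis using assms by auto
qed

lemma openin_Collect_imp:
  assumes "A \<Longrightarrow> openin X {x \<in> topspace X. P x}"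
  shows "openin X {x \<in> topspace X. A \<longrightarrow> P x}"
  using assms by (cases A) auto

lemma openin_Collect_less:
  assumes "continuous_map X euclideanreal f" "continuous_map X euclideanreal g"
  shows "openin X {x \<in> topspace X. f x < g x}"
proof -
  have "continuous_map X euclideanreal (\<lambda>x. g x - f x)" using assms by (intro continuous_map_diff)
  then have "openin X {x \<in> topspace X. g x - f x \<in> {0<..}}"
    by (rule openin_continuous_map_preimage) auto
  then show ?thesis by simp
qed

lemma openin_Collect_neq:
  assumes "continuous_map X euclideanreal f" "continuous_map X euclideanreal g"
  shows "openin X {x \<in> topspace X. f x \<noteq> g x}"
  unfolding neq_iff using assms by (intro openin_Collect_disj openin_Collect_less)

lemma continuous_map_side:
  assumes "i \<in> {1..n}"
  shows "continuous_map (prod_topology (configuration_space n euclidean) (configuration_space n euclidean))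
    euclidean (\<lambda>z. side b z i)"
  using continuous_map_compose[OF continuous_map_fst continuous_map_configuration_space_nth[OF assms]]
    continuous_map_compose[OF continuous_map_snd continuous_map_configuration_space_nth[OF assms]]
  by (cases b) (simp_all add: side_def comp_def)

lemma continuous_map_vec_nth:
  assumes "continuous_map X euclidean f"
  shows "continuous_map X euclideanreal (\<lambda>x. f x $ k :: real)"
  using assms by (simp add: continuous_map_atin tendsto_vec_nth)

lemma openin_stratum_nbhd:
  "openin (prod_topology (configuration_space n euclidean) (configuration_space n euclidean))
    (stratum_nbhd n \<rho>)"
  unfolding stratum_nbhd_def height_def
  by (intro openin_Collect_ball openin_Collect_conj openin_Collect_imp openin_Collect_disj
      openin_Collect_less openin_Collect_neq continuous_map_real_abs continuous_map_diff
      continuous_map_vec_nth continuous_map_side finite_particles) (auto simp: particles_def)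

lemma continuous_map_vector3:
  assumes "continuous_map X euclideanreal f" "continuous_map X euclideanreal g" "continuous_map X euclideanreal h"
  shows "continuous_map X euclidean (\<lambda>x. vector [f x, g x, h x] :: real ^ 3)"
proof -
  have "((\<lambda>y. vector [f y, g y, h y] :: real ^ 3) \<longlongrightarrow> vector [f x, g x, h x]) (atin X x)"
    if "x \<in> topspace X" for x
  proof (rule vec_tendstoI)
    fix i :: 3
    show "((\<lambda>y. (vector [f y, g y, h y] :: real ^ 3) $ i) \<longlongrightarrow> (vector [f x, g x, h x] :: real ^ 3) $ i) (atin X x)"
      using exhaust_3[of i] assms that by (elim disjE) (simp_all add: continuous_map_atin)
  qed
  then show ?thesis by (simp add: continuous_map_atin)
qed

text \<open>Lexicographic in the rank and the index: as \<open>i \<le> n\<close>, particles get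
  distinct heights that respect the ranks.\<close>

definition target :: "nat \<Rightarrow> (bool \<times> nat \<Rightarrow> nat) \<Rightarrow> bool \<Rightarrow> nat \<Rightarrow> real" where
  "target n \<rho> b i = real (\<rho> (b, i) * Suc n + i)"

lemma target_less:
  assumes "i \<in> {1..n}" "j \<in> {1..n}" "\<rho> (b, i) < \<rho> (b, j)"
  shows "target n \<rho> b i < target n \<rho> b j"
proof -
  have "\<rho> (b, i) * Suc n + i < Suc (\<rho> (b, i)) * Suc n" using assms(1) by simp
  also have "\<dots> \<le> \<rho> (b, j) * Suc n" using assms(3) by (intro mult_le_mono1) simp
  finally show ?thesis unfolding target_def of_nat_less_iff by linarith
qed

lemma target_neq:
  assumes "i \<in> {1..n}" "j \<in> {1..n}" "i \<noteq> j"
  shows "target n \<rho> b i \<noteq> target n \<rho> b j"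
proof (cases "\<rho> (b, i) = \<rho> (b, j)")
  case True
  then show ?thesis using assms by (simp add: target_def)
next
  case False
  then show ?thesis
    using target_less[OF assms(1,2)] target_less[OF assms(2,1)] by (metis less_irrefl nat_neq_iff)
qed

text \<open>Linear moves: first the heights go to their targets, with particles of equal rank kept
  apart by the other two coordinates; then those coordinates go to fixed values, with the heights
  keeping particles apart. The two resulting fixed configurations share their second coordinates, so
  a last linear move connects them.\<close>

lemma has_motion_planner_stratum_nbhd:
  "has_motion_planner (configuration_space n euclidean) (stratum_nbhd n \<rho>)"
proof -
  let ?M = "configuration_space n (euclidean :: (real ^ 3) topology)"
  let ?Z = "subtopology (prod_topology ?M ?M) (stratum_nbhd n \<rho>)"
  define A where "A b z = (\<lambda>i\<in>{1..n}. vector [target n \<rho> b i, side b z i $ 2, side b z i $ 3] :: real ^ 3)" for b z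
  define B where "B b = (\<lambda>i\<in>{1..n}. vector [target n \<rho> b i, real i, 0] :: real ^ 3)" for b
  have sub: "stratum_nbhd n \<rho> \<subseteq> topspace (prod_topology ?M ?M)"
    by (rule openin_subset[OF openin_stratum_nbhd])
  have cont: "continuous_map ?Z euclidean (\<lambda>z. side b z i)" if "i \<in> {1..n}" for b i
    by (rule continuous_map_from_subtopology[OF continuous_map_side[OF that]])
  have contA: "continuous_map ?Z euclidean (\<lambda>z. A b z i)" if "i \<in> {1..n}" for b i
  proof -
    have "continuous_map ?Z euclidean (\<lambda>z. vector [target n \<rho> b i, side b z i $ 2, side b z i $ 3] :: real ^ 3)"
      by (intro continuous_map_vector3 continuous_map_vec_nth cont that continuous_map_canonical_const)
    then show ?thesis using that by (simp add: A_def)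
  qed
  have ext: "side b z \<in> extensional {1..n}" if "z \<in> topspace ?Z" for b z
  proof -
    have "z \<in> topspace ?M \<times> topspace ?M" using that sub by (simp only: topspace_subtopology topspace_prod_topology Int_iff)
    then have "side b z \<in> topspace ?M" by (cases b) (auto simp: side_def)
    then show ?thesis by (simp add: topspace_configuration_space)
  qed
  have 1: "homotopic_with (\<lambda>_. True) ?Z ?M (side b) (A b)" for b
  proof (rule homotopic_configurations_linear)
    fix z i j assume z: "z \<in> topspace ?Z" and ij: "i \<in> {1..n}" "j \<in> {1..n}" "i \<noteq> j"
    have zs: "z \<in> stratum_nbhd n \<rho>" using z by simp
    have p: "(b, i) \<in> particles n" "(b, j) \<in> particles n" using ij by (auto simp: particles_def)
    have less: "side b z i $ 1 < side b z j $ 1" if "\<rho> (b, i) < \<rho> (b, j)" "i \<in> {1..n}" "j \<in> {1..n}" for i j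
    proof -
      have "(b, i) \<in> particles n" "(b, j) \<in> particles n" using that by (auto simp: particles_def)
      then have "height z (b, i) < height z (b, j)"
        using stratum_nbhd_less[OF zs] that(1) by simp
      then show ?thesis by (simp add: height_def)
    qed
    have neq: "side b z i $ 2 \<noteq> side b z j $ 2 \<or> side b z i $ 3 \<noteq> side b z j $ 3" if "\<rho> (b, i) = \<rho> (b, j)"
      using stratum_nbhd_separated[OF zs p] that ij(3) by (simp add: level_def)
    have A: "A b z i $ 1 = target n \<rho> b i" "A b z i $ 2 = side b z i $ 2" "A b z i $ 3 = side b z i $ 3"
       if "i \<in> {1..n}" for i
      using that by (simp_all add: A_def)
    consider "\<rho> (b, i) < \<rho> (b, j)" | "\<rho> (b, j) < \<rho> (b, i)" | "side b z i $ 2 \<noteq> side b z j $ 2"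
      | "side b z i $ 3 \<noteq> side b z j $ 3" using neq by linarith
    then show "\<exists>k. 0 < (side b z i $ k - side b z j $ k) * (A b z i $ k - A b z j $ k)"
    proof cases
      case 1
      then show ?thesis
        using less[OF 1 ij(1,2)] target_less[OF ij(1,2) 1] A(1)[OF ij(1)] A(1)[OF ij(2)]
        by (intro exI[of _ 1]) (simp add: mult_neg_neg)
    next
      case 2
      then show ?thesis
        using less[OF 2 ij(2,1)] target_less[OF ij(2,1) 2] A(1)[OF ij(1)] A(1)[OF ij(2)]
        by (intro exI[of _ 1]) (simp add: mult_pos_pos)
    next
      case 3
      then show ?thesis
        using A(2)[OF ij(1)] A(2)[OF ij(2)] by (intro exI[of _ 2]) (simp add: zero_less_mult_iff, linarith)
    next
      case 4
      then show ?thesis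
        using A(3)[OF ij(1)] A(3)[OF ij(2)] by (intro exI[of _ 3]) (simp add: zero_less_mult_iff, linarith)
    qed
  qed (erule cont contA ext | simp add: A_def)+
  have 2: "homotopic_with (\<lambda>_. True) ?Z ?M (A b) (\<lambda>_. B b)" for b
  proof (rule homotopic_configurations_linear)
    fix z i j assume ij: "i \<in> {1..n}" "j \<in> {1..n}" "i \<noteq> j"
    then show "\<exists>k. 0 < (A b z i $ k - A b z j $ k) * (B b i $ k - B b j $ k)"
      using target_neq[OF ij, of \<rho> b]
      by (intro exI[of _ 1]) (simp add: A_def B_def zero_less_mult_iff, linarith)
  qed (erule contA | simp add: A_def B_def)+
  have 3: "homotopic_with (\<lambda>_. True) ?Z ?M (\<lambda>_. B False) (\<lambda>_. B True)"
  proof (rule homotopic_configurations_linear)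
    fix z i j assume ij: "i \<in> {1..n}" "j \<in> {1..n}" "i \<noteq> j"
    then show "\<exists>k. 0 < (B False i $ k - B False j $ k) * (B True i $ k - B True j $ k)"
      by (intro exI[of _ 2]) (auto simp: B_def zero_less_mult_iff)
  qed (simp_all add: B_def)
  have "homotopic_with (\<lambda>_. True) ?Z ?M (side False) (side True)"
    by (rule homotopic_with_trans[OF homotopic_with_trans[OF 1 2] homotopic_with_trans[OF 3
          homotopic_with_symD[OF homotopic_with_trans[OF 1 2]]]])
  moreover have "side False = fst" "side True = snd"
    by (auto simp: side_def fun_eq_iff)
  ultimately show ?thesis
    unfolding has_motion_planner_iff_homotopic[OF sub] by (simp only:)
qed

lemma configuration_space_cover_upper_bound:
  assumes n: "n \<ge> 1"
  defines "M \<equiv> configuration_space n (euclidean :: (real ^ 3) topology)"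
  shows "\<exists>U. (\<forall>i\<in>{1..2 * n - 1}. openin (prod_topology M M) (U i) \<and> has_motion_planner M (U i)) \<and>
    (\<Union>i\<in>{1..2 * n - 1}. U i) = topspace (prod_topology M M)"
proof -
  let ?MM = "prod_topology M M"
  define levels where "levels \<rho> = card (level \<rho> ` particles n)" for \<rho>
  \<comment> \<open>The numbers of blocks run from 2 to \<open>2 * n\<close>, hence the shift by
    one.\<close>
  define R where "R l = {\<rho>. \<rho> \<in> range (height_rank n) \<and> levels \<rho> = Suc l}" for l
  define U where "U l = (\<Union>\<rho>\<in>R l. stratum_nbhd n \<rho>)" for l
  have U_open: "openin ?MM (U l)" for l
    unfolding U_def M_def
  proof (rule openin_Union)
    fix S assume "S \<in> stratum_nbhd n ` R l"
    then obtain \<rho> where "S = stratum_nbhd n \<rho>" by (rule imageE)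
    then show "openin (prod_topology (configuration_space n euclidean) (configuration_space n euclidean)) S"
      using openin_stratum_nbhd[of n \<rho>] by simp
  qed
  have U_planner: "has_motion_planner M (U l)" for l
    unfolding U_def M_def
  proof (rule has_motion_planner_disjoint_Union)
    fix \<rho> \<rho>'
    assume R: "\<rho> \<in> R l" "\<rho>' \<in> R l" and meet: "stratum_nbhd n \<rho> \<inter> stratum_nbhd n \<rho>' \<noteq> {}"
    obtain x where x: "\<rho> = height_rank n x" using R(1) unfolding R_def by auto
    obtain y where y: "\<rho>' = height_rank n y" using R(2) unfolding R_def by auto
    obtain z where "z \<in> stratum_nbhd n \<rho>" "z \<in> stratum_nbhd n \<rho>'"
      using ex_in_conv[THEN iffD2, OF meet] by (elim exE IntE)
    moreover have "levels \<rho> = levels \<rho>'" using R unfolding R_def by simp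
    ultimately show "\<rho> = \<rho>'"
      unfolding x y levels_def by (rule stratum_nbhd_disjoint)
  next
    show "openin (prod_topology (configuration_space n euclidean) (configuration_space n euclidean)) (stratum_nbhd n \<rho>)" for \<rho>
      by (rule openin_stratum_nbhd)
    show "has_motion_planner (configuration_space n euclidean) (stratum_nbhd n \<rho>)" for \<rho>
      by (rule has_motion_planner_stratum_nbhd)
  qed
  have U_cover: "z \<in> (\<Union>i\<in>{1..2 * n - 1}. U i)" if z: "z \<in> topspace ?MM" for z
  proof -
    define \<rho> where "\<rho> = height_rank n z"
    \<comment> \<open>The first particles of the two configurations always lie in different
      blocks.\<close>
    have "level \<rho> ` {(False, 1), (True, 1)} \<subseteq> level \<rho> ` particles n"
      using n by (intro image_mono) (auto simp: particles_def)
    then have "card (level \<rho> ` {(False, 1), (True, 1)}) \<le> levels \<rho>"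
      unfolding levels_def by (rule card_mono[rotated]) simp
    then have "2 \<le> levels \<rho>" by (simp add: level_def)
    moreover have "levels \<rho> \<le> 2 * n"
      unfolding levels_def using card_image_le[of "particles n" "level \<rho>"] card_particles[of n] by simp
    moreover have "z \<in> stratum_nbhd n \<rho>"
      unfolding \<rho>_def using z unfolding M_def by (rule in_stratum_nbhd_height_rank)
    moreover have "\<rho> \<in> R (levels \<rho> - 1)"
      using \<open>2 \<le> levels \<rho>\<close> by (simp add: R_def \<rho>_def)
    ultimately have "levels \<rho> - 1 \<in> {1..2 * n - 1}" "z \<in> U (levels \<rho> - 1)"
      unfolding U_def by auto
    then show ?thesis by blast
  qed
  have "(\<Union>i\<in>{1..2 * n - 1}. U i) = topspace ?MM"
  proof
    show "(\<Union>i\<in>{1..2 * n - 1}. U i) \<subseteq> topspace ?MM"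
      by (rule UN_least) (rule openin_subset[OF U_open])
    show "topspace ?MM \<subseteq> (\<Union>i\<in>{1..2 * n - 1}. U i)"
      using U_cover by (rule subsetI)
  qed
  with U_open U_planner show ?thesis by (intro exI[of _ U] conjI ballI)
qed

section \<open>Comparison of the two bounds\<close>

theorem theorem13:
  fixes n :: nat
  assumes "n \<ge> 1"
  shows "topological_complexity (configuration_space n (euclidean :: (real ^ 3) topology))
    = enat (2 * n - 1)"
  unfolding topological_complexity_def
proof (rule antisym)
  let ?M = "configuration_space n (euclidean :: (real ^ 3) topology)"
  let ?good = "\<lambda>k U. (\<forall>i\<in>{1..k}. openin (prod_topology ?M ?M) (U i) \<and> has_motion_planner ?M (U i)) \<and>
    (\<Union>i\<in>{1..k}. U i) = topspace (prod_topology ?M ?M)"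
  show "Inf {enat k |k. \<exists>U :: nat \<Rightarrow> _. ?good k U} \<le> enat (2 * n - 1)"
    by (rule Inf_lower) (use configuration_space_cover_upper_bound[OF assms] in blast)
  show "enat (2 * n - 1) \<le> Inf {enat k |k. \<exists>U :: nat \<Rightarrow> _. ?good k U}"
  proof (rule Inf_greatest)
    fix e assume "e \<in> {enat k |k. \<exists>U :: nat \<Rightarrow> _. ?good k U}"
    then obtain k and U :: "nat \<Rightarrow> _" where e: "e = enat k" and U: "?good k U" by blast
    have "2 * n - 1 \<le> k"
    proof (rule configuration_space_cover_lower_bound[OF assms, where U = "\<lambda>i. U (Suc i)"])
      \<comment> \<open>The cover is reindexed from 0, so that \<open>i div 2\<close> pairs the
        planners correctly.\<close>
      have "{1..k} = Suc ` {..<k}" by (simp add: lessThan_atLeast0 image_Suc_atLeastLessThan atLeastLessThanSuc_atLeastAtMost)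
      then show "(\<Union>i<k. U (Suc i)) = topspace (prod_topology ?M ?M)"
        using U by (simp add: image_image)
    qed (use U in auto)
    then show "enat (2 * n - 1) \<le> e" by (simp add: e)
  qed
qed

end
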